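(* Let $\mathcal{C}$ be a semi-monoidal 2-category with an object $I$, natural transformations $\lambda,\rho$ with equi-arrow components $\lambda_X:IX\to X$, $\rho_X:XI\to X$, and a family of invertible 2-cells $K_{X,Y}:X\lambda_Y\Rightarrow\rho_XY$ natural in $X$ and $Y$. Let $K^\lambda_{X,Y}:\lambda_{XY}\Rightarrow\lambda_XY$ and $K^\rho_{X,Y}:X\rho_Y\Rightarrow\rho_{XY}$ be the induced 2-cells, put $\alpha:=\lambda_I$, and define $$L_X:=N^\lambda_X\bullet K^\lambda_{I,X}: I\lambda_X\Rightarrow\lambda_{IX}\Rightarrow\lambda_IX=\alpha X,\qquad R_X:=K_{X,I}:X\alpha=X\lambda_I\Rightarrow\rho_XI .$$ The following are equivalent: (i) $L$ and $R$ are compatible with $K$: for all $X,Y$, $(R_XY\#X\lambda_Y)\bullet(XL_Y\#\rho_XY)=X\alpha Y\#K_{X,Y}$. (ii) $K$ is coherent on the left: for all $X,Y,Z$, $(XK^\lambda_{Y,Z})\bullet(K_{X,Y}Z)=K_{X,YZ}$. (ii') $K$ is coherent on the right: for all $X,Y,Z$, $(XK_{Y,Z})\bullet(K^\rho_{X,Y}Z)=K_{XY,Z}$.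
   Context: A semi-monoidal 2-category $\mathcal{C}$ is a strict 2-category with a strict 2-functor $\mathcal{C}\times\mathcal{C}\to\mathcal{C}$, $(X,Y)\mapsto XY$ (tensor product, written by juxtaposition), strictly associative. No unit is assumed. $\#$ denotes composition of arrows and horizontal composition of 2-cells (including whiskering), written left to right; $\bullet$ denotes vertical composition of 2-cells, also left to right. The name of an object (arrow) also denotes its identity arrow (identity 2-cell). An equi-arrow is an arrow admitting a pseudo-inverse. Natural transformations are pseudo-natural: for $f:X\to X'$ there are invertible 2-cells $\lambda_f:If\#\lambda_{X'}\Rightarrow\lambda_X\#f$ and $\rho_f:fI\#\rho_{X'}\Rightarrow\rho_X\#f$ with the usual compatibilities. Naturality of $K$ means: for $f:X\to X'$, $g:Y\to Y'$, $(f\lambda_g)\bullet(K_{X,Y}\#fg)=(fIg\#K_{X',Y'})\bullet(\rho_fg)$ as 2-cells $fIg\#X'\lambda_{Y'}\Rightarrow\rho_XY\#fg$. Under these hypotheses $I$ is cancellable (tensoring with $I$ on either side induces equivalences on hom categories). $K^\lambda$ and $K^\rho$ are the unique 2-cells such that $$(IK^\lambda_{Y,Z})\bullet(K_{I,Y}Z)=K_{I,YZ},\qquad (XK_{Y,I})\bullet(K^\rho_{X,Y}I)=K_{XY,I}.$$ $N^\lambda_X:I\lambda_X\Rightarrow\lambda_{IX}$ is the unique (invertible) 2-cell with $N^\lambda_X\#\lambda_X=\lambda_{(\lambda_X)}$, the naturality 2-cell of $\lambda$ at the arrow $\lambda_X$. In (i), the left-hand side is the composite $X\alpha Y\#X\lambda_Y\Rightarrow\rho_XIY\#X\lambda_Y=XI\lambda_Y\#\rho_XY\Rightarrow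 X\alpha Y\#\rho_XY$. *)

theory Defs
  imports Main
begin

text \<open>
  Strict 2-categories are presented as in Mac Lane, Categories for the Working Mathematician,
  XII.3: a set of 2-cells carrying two category structures. Objects and arrows are represented by
  their identity 2-cells, so that one name denotes an object, its identity arrow and the identity
  2-cell of that arrow. All compositions are written from left to right.
\<close>

record 'c two_cat =
  Cells :: "'c set"
  src :: "'c \<Rightarrow> 'c"  \<comment> \<open>source object\<close>
  tgt :: "'c \<Rightarrow> 'c"  \<comment> \<open>target object\<close>
  dom2 :: "'c \<Rightarrow> 'c"  \<comment> \<open>domain arrow of a 2-cell\<close>
  cod2 :: "'c \<Rightarrow> 'c"  \<comment> \<open>codomain arrow of a 2-cell\<close>
  hcomp :: "'c \<Rightarrow> 'c \<Rightarrow> 'c" (infixl "\<star>\<index>" 70)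
  vcomp :: "'c \<Rightarrow> 'c \<Rightarrow> 'c" (infixl "\<bullet>\<index>" 65)

record 'c tensor_two_cat = "'c two_cat" +
  tensor :: "'c \<Rightarrow> 'c \<Rightarrow> 'c" (infixl "\<otimes>\<index>" 80)

text \<open>
  A category given by its set \<open>A\<close> of arrows alone, with source \<open>s\<close>, target \<open>t\<close> (both valued
  in identity arrows) and composition \<open>m\<close>, constrained only on composable pairs.
\<close>

locale arrows_only_category =
  fixes A :: "'c set" and s t :: "'c \<Rightarrow> 'c" and m :: "'c \<Rightarrow> 'c \<Rightarrow> 'c"
  assumes source_closed: "a \<in> A \<Longrightarrow> s a \<in> A"
    and target_closed: "a \<in> A \<Longrightarrow> t a \<in> A"
    and source_source: "a \<in> A \<Longrightarrow> s (s a) = s a"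
    and target_source: "a \<in> A \<Longrightarrow> t (s a) = s a"
    and source_target: "a \<in> A \<Longrightarrow> s (t a) = t a"
    and target_target: "a \<in> A \<Longrightarrow> t (t a) = t a"
    and comp_closed: "\<lbrakk>a \<in> A; b \<in> A; t a = s b\<rbrakk> \<Longrightarrow> m a b \<in> A"
    and source_comp: "\<lbrakk>a \<in> A; b \<in> A; t a = s b\<rbrakk> \<Longrightarrow> s (m a b) = s a"
    and target_comp: "\<lbrakk>a \<in> A; b \<in> A; t a = s b\<rbrakk> \<Longrightarrow> t (m a b) = t b"
    and comp_unit_left: "a \<in> A \<Longrightarrow> m (s a) a = a"
    and comp_unit_right: "a \<in> A \<Longrightarrow> m a (t a) = a"
    and comp_assoc: "\<lbrakk>a \<in> A; b \<in> A; c \<in> A; t a = s b; t b = s c\<rbrakk>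
      \<Longrightarrow> m (m a b) c = m a (m b c)"

locale two_category =
  horizontal: arrows_only_category "Cells C" "src C" "tgt C" "hcomp C" +
  vertical: arrows_only_category "Cells C" "dom2 C" "cod2 C" "vcomp C"
  for C :: "('c, 'm) two_cat_scheme" (structure) +
  assumes src_dom: "a \<in> Cells C \<Longrightarrow> src C (dom2 C a) = src C a"
    and src_cod: "a \<in> Cells C \<Longrightarrow> src C (cod2 C a) = src C a"
    and tgt_dom: "a \<in> Cells C \<Longrightarrow> tgt C (dom2 C a) = tgt C a"
    and tgt_cod: "a \<in> Cells C \<Longrightarrow> tgt C (cod2 C a) = tgt C a"
    \<comment> \<open>identities of the horizontal composition are identities of the vertical one\<close>
    and dom_src: "a \<in> Cells C \<Longrightarrow> dom2 C (src C a) = src C a"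
    and dom_tgt: "a \<in> Cells C \<Longrightarrow> dom2 C (tgt C a) = tgt C a"
    and dom_hcomp: "\<lbrakk>a \<in> Cells C; b \<in> Cells C; tgt C a = src C b\<rbrakk>
      \<Longrightarrow> dom2 C (a \<star> b) = dom2 C a \<star> dom2 C b"
    and cod_hcomp: "\<lbrakk>a \<in> Cells C; b \<in> Cells C; tgt C a = src C b\<rbrakk>
      \<Longrightarrow> cod2 C (a \<star> b) = cod2 C a \<star> cod2 C b"
    and interchange: "\<lbrakk>a \<in> Cells C; a' \<in> Cells C; b \<in> Cells C; b' \<in> Cells C;
        cod2 C a = dom2 C a'; cod2 C b = dom2 C b'; tgt C a = src C b\<rbrakk>
      \<Longrightarrow> (a \<bullet> a') \<star> (b \<bullet> b') = (a \<star> b) \<bullet> (a' \<star> b')"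

definition Obj :: "('c, 'm) two_cat_scheme \<Rightarrow> 'c set" where
  "Obj C = {X \<in> Cells C. src C X = X}"

definition hom :: "('c, 'm) two_cat_scheme \<Rightarrow> 'c \<Rightarrow> 'c \<Rightarrow> 'c set" where
  "hom C X Y = {f \<in> Cells C. dom2 C f = f \<and> src C f = X \<and> tgt C f = Y}"

definition two_hom :: "('c, 'm) two_cat_scheme \<Rightarrow> 'c \<Rightarrow> 'c \<Rightarrow> 'c set" where
  "two_hom C f g = {\<theta> \<in> Cells C. dom2 C \<theta> = f \<and> cod2 C \<theta> = g}"

definition inv_two_hom :: "('c, 'm) two_cat_scheme \<Rightarrow> 'c \<Rightarrow> 'c \<Rightarrow> 'c set" where
  "inv_two_hom C f g = {\<theta> \<in> two_hom C f g.
     \<exists>\<psi> \<in> two_hom C g f. \<theta> \<bullet>\<^bsub>C\<^esub> \<psi> = f \<and> \<psi> \<bullet>\<^bsub>C\<^esub> \<theta> = g}"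

definition equi_arrow :: "('c, 'm) two_cat_scheme \<Rightarrow> 'c \<Rightarrow> 'c \<Rightarrow> 'c \<Rightarrow> bool" where
  "equi_arrow C f X Y \<longleftrightarrow> f \<in> hom C X Y \<and>
     (\<exists>g \<in> hom C Y X. inv_two_hom C (f \<star>\<^bsub>C\<^esub> g) X \<noteq> {} \<and> inv_two_hom C (g \<star>\<^bsub>C\<^esub> f) Y \<noteq> {})"

text \<open>
  A strict 2-functor preserves identities because it preserves sources, targets, domains and
  codomains, whose values are the identities.
\<close>

definition strict_two_functor ::
  "('c, 'm) two_cat_scheme \<Rightarrow> ('d, 'n) two_cat_scheme \<Rightarrow> ('c \<Rightarrow> 'd) \<Rightarrow> bool" where
  "strict_two_functor C D F \<longleftrightarrow>
     (\<forall>a \<in> Cells C. F a \<in> Cells D \<and>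
        F (src C a) = src D (F a) \<and> F (tgt C a) = tgt D (F a) \<and>
        F (dom2 C a) = dom2 D (F a) \<and> F (cod2 C a) = cod2 D (F a)) \<and>
     (\<forall>a \<in> Cells C. \<forall>b \<in> Cells C. tgt C a = src C b \<longrightarrow>
        F (a \<star>\<^bsub>C\<^esub> b) = F a \<star>\<^bsub>D\<^esub> F b) \<and>
     (\<forall>a \<in> Cells C. \<forall>b \<in> Cells C. cod2 C a = dom2 C b \<longrightarrow>
        F (a \<bullet>\<^bsub>C\<^esub> b) = F a \<bullet>\<^bsub>D\<^esub> F b)"

definition prod_two_cat ::
  "('c, 'm) two_cat_scheme \<Rightarrow> ('d, 'n) two_cat_scheme \<Rightarrow> ('c \<times> 'd) two_cat" where
  "prod_two_cat C D = \<lparr>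
     Cells = Cells C \<times> Cells D,
     src = map_prod (src C) (src D),
     tgt = map_prod (tgt C) (tgt D),
     dom2 = map_prod (dom2 C) (dom2 D),
     cod2 = map_prod (cod2 C) (cod2 D),
     hcomp = (\<lambda>(a, b) (a', b'). (a \<star>\<^bsub>C\<^esub> a', b \<star>\<^bsub>D\<^esub> b')),
     vcomp = (\<lambda>(a, b) (a', b'). (a \<bullet>\<^bsub>C\<^esub> a', b \<bullet>\<^bsub>D\<^esub> b'))\<rparr>"

locale semi_monoidal_two_category = two_category C
  for C :: "('c, 'm) tensor_two_cat_scheme" (structure) +
  assumes tensor_two_functor: "strict_two_functor (prod_two_cat C C) C (\<lambda>(a, b). a \<otimes> b)"
    and tensor_assoc: "\<lbrakk>a \<in> Cells C; b \<in> Cells C; c \<in> Cells C\<rbrakk> \<Longrightarrow> (a \<otimes> b) \<otimes> c = a \<otimes> (b \<otimes> c)"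

text \<open>
  Pseudo-natural transformations from \<open>F\<close> to \<open>G\<close> with components \<open>t X\<close> at objects and
  naturality 2-cells \<open>n f\<close> at arrows.
\<close>

definition pseudo_natural ::
  "('c, 'm) two_cat_scheme \<Rightarrow> ('d, 'n) two_cat_scheme \<Rightarrow> ('c \<Rightarrow> 'd) \<Rightarrow> ('c \<Rightarrow> 'd) \<Rightarrow>
   ('c \<Rightarrow> 'd) \<Rightarrow> ('c \<Rightarrow> 'd) \<Rightarrow> bool" where
  "pseudo_natural C D F G t n \<longleftrightarrow>
     (\<forall>X \<in> Obj C. t X \<in> hom D (F X) (G X)) \<and>
     (\<forall>X \<in> Obj C. \<forall>Y \<in> Obj C. \<forall>f \<in> hom C X Y.
        n f \<in> inv_two_hom D (F f \<star>\<^bsub>D\<^esub> t Y) (t X \<star>\<^bsub>D\<^esub> G f)) \<and>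
     (\<forall>X \<in> Obj C. n X = t X) \<and>
     (\<forall>X \<in> Obj C. \<forall>Y \<in> Obj C. \<forall>Z \<in> Obj C. \<forall>f \<in> hom C X Y. \<forall>g \<in> hom C Y Z.
        n (f \<star>\<^bsub>C\<^esub> g) = (F f \<star>\<^bsub>D\<^esub> n g) \<bullet>\<^bsub>D\<^esub> (n f \<star>\<^bsub>D\<^esub> G g)) \<and>
     (\<forall>X \<in> Obj C. \<forall>Y \<in> Obj C. \<forall>f \<in> hom C X Y. \<forall>g \<in> hom C X Y. \<forall>\<theta> \<in> two_hom C f g.
        (F \<theta> \<star>\<^bsub>D\<^esub> t Y) \<bullet>\<^bsub>D\<^esub> n g = n f \<bullet>\<^bsub>D\<^esub> (t X \<star>\<^bsub>D\<^esub> G \<theta>))"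

text \<open>Naturality of \<open>K\<close> in both variables; \<open>ln\<close> and \<open>rn\<close> are the naturality 2-cells of \<open>l\<close> and \<open>r\<close>.\<close>

definition natural_K ::
  "('c, 'm) tensor_two_cat_scheme \<Rightarrow> 'c \<Rightarrow> ('c \<Rightarrow> 'c) \<Rightarrow> ('c \<Rightarrow> 'c) \<Rightarrow> ('c \<Rightarrow> 'c) \<Rightarrow> ('c \<Rightarrow> 'c) \<Rightarrow>
   ('c \<Rightarrow> 'c \<Rightarrow> 'c) \<Rightarrow> bool" where
  "natural_K C I l ln r rn K \<longleftrightarrow>
     (\<forall>X \<in> Obj C. \<forall>X' \<in> Obj C. \<forall>Y \<in> Obj C. \<forall>Y' \<in> Obj C. \<forall>f \<in> hom C X X'. \<forall>g \<in> hom C Y Y'.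
        (f \<otimes>\<^bsub>C\<^esub> ln g) \<bullet>\<^bsub>C\<^esub> (K X Y \<star>\<^bsub>C\<^esub> (f \<otimes>\<^bsub>C\<^esub> g)) =
        ((f \<otimes>\<^bsub>C\<^esub> I \<otimes>\<^bsub>C\<^esub> g) \<star>\<^bsub>C\<^esub> K X' Y') \<bullet>\<^bsub>C\<^esub> (rn f \<otimes>\<^bsub>C\<^esub> g))"

definition K_left ::
  "('c, 'm) tensor_two_cat_scheme \<Rightarrow> 'c \<Rightarrow> ('c \<Rightarrow> 'c) \<Rightarrow> ('c \<Rightarrow> 'c \<Rightarrow> 'c) \<Rightarrow> 'c \<Rightarrow> 'c \<Rightarrow> 'c" where
  "K_left C I l K Y Z = (THE k. k \<in> two_hom C (l (Y \<otimes>\<^bsub>C\<^esub> Z)) (l Y \<otimes>\<^bsub>C\<^esub> Z) \<and>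
     (I \<otimes>\<^bsub>C\<^esub> k) \<bullet>\<^bsub>C\<^esub> (K I Y \<otimes>\<^bsub>C\<^esub> Z) = K I (Y \<otimes>\<^bsub>C\<^esub> Z))"

definition K_right ::
  "('c, 'm) tensor_two_cat_scheme \<Rightarrow> 'c \<Rightarrow> ('c \<Rightarrow> 'c) \<Rightarrow> ('c \<Rightarrow> 'c \<Rightarrow> 'c) \<Rightarrow> 'c \<Rightarrow> 'c \<Rightarrow> 'c" where
  "K_right C I r K X Y = (THE k. k \<in> two_hom C (X \<otimes>\<^bsub>C\<^esub> r Y) (r (X \<otimes>\<^bsub>C\<^esub> Y)) \<and>
     (X \<otimes>\<^bsub>C\<^esub> K Y I) \<bullet>\<^bsub>C\<^esub> (k \<otimes>\<^bsub>C\<^esub> I) = K (X \<otimes>\<^bsub>C\<^esub> Y) I)"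

definition N_left ::
  "('c, 'm) tensor_two_cat_scheme \<Rightarrow> 'c \<Rightarrow> ('c \<Rightarrow> 'c) \<Rightarrow> ('c \<Rightarrow> 'c) \<Rightarrow> 'c \<Rightarrow> 'c" where
  "N_left C I l ln X = (THE k. k \<in> two_hom C (I \<otimes>\<^bsub>C\<^esub> l X) (l (I \<otimes>\<^bsub>C\<^esub> X)) \<and>
     k \<star>\<^bsub>C\<^esub> l X = ln (l X))"

end

(* Whiskering by an equi-arrow is fully faithful on 2-cells, and hence so is tensoring with I.
   Naturality of K at lam Y turns compatibility for (X, Y) into left coherence for (X, I, Y).
   Left coherence at triples with middle object I gives right coherence at triples (X, Y, IZ), and
   the equi-arrow lam Z: IZ -> Z transports it to (X, Y, Z). Symmetrically, right coherence with
   middle object I gives left coherence at (XI, Y, Z), which rho X transports to (X, Y, Z). *)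
theory Submission
  imports Defs
begin

text \<open>The defining equations of \<open>Kl\<close> and \<open>Kr\<close> are themselves
  instances of coherence: left coherence at triples (I, Y, Z) and right coherence at triples (X, Y,
  I). Condition (i) speaks only of \<open>I\<close> in the middle, so the obstacle is an arbitrary
  middle object. Exchanging the two sides overcomes it: two instances of coherence around a middle
  \<open>I\<close>, glued by the defining equation for the other side, free the middle object but
  leave an extra \<open>I\<close> beside an outer one, which is why a transport has to follow. Full
  faithfulness enters twice: fullness gives the definite descriptions \<open>K_left\<close>,
  \<open>K_right\<close> and \<open>N_left\<close> a value and faithfulness makes it unique;
  faithfulness also removes the whiskerings that naturality introduces.\<close>

context two_category
begin

section \<open>Boundaries and whiskering of 2-cells\<close>

lemmas cell_simps =
  horizontal.source_closed horizontal.target_closed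
  horizontal.source_source horizontal.target_source
  horizontal.source_target horizontal.target_target
  horizontal.comp_closed horizontal.source_comp horizontal.target_comp
  horizontal.comp_unit_left horizontal.comp_unit_right
  vertical.source_closed vertical.target_closed
  vertical.source_source vertical.target_source
  vertical.source_target vertical.target_target
  vertical.comp_closed vertical.source_comp vertical.target_comp
  vertical.comp_unit_left vertical.comp_unit_right
  src_dom src_cod tgt_dom tgt_cod dom_src dom_tgt dom_hcomp cod_hcomp

text \<open>Compositions are total functions constrained only on matching boundaries, so most side
  conditions are boundary computations and go to the simplifier. Associativity stays out, because
  the proofs rebracket in both directions.\<close>

declare cell_simps [simp]

lemma cod_arrow: "\<lbrakk>f \<in> Cells C; dom2 C f = f\<rbrakk> \<Longrightarrow> cod2 C f = f"
  using vertical.target_source by metis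

lemma src_vcomp [simp]:
  assumes "a \<in> Cells C" "b \<in> Cells C" "cod2 C a = dom2 C b"
  shows "src C (a \<bullet> b) = src C a"
  using assms src_dom[of "a \<bullet> b"] by simp

lemma tgt_vcomp [simp]:
  assumes "a \<in> Cells C" "b \<in> Cells C" "cod2 C a = dom2 C b"
  shows "tgt C (a \<bullet> b) = tgt C a"
  using assms tgt_dom[of "a \<bullet> b"] by simp

lemma ObjD:
  assumes "X \<in> Obj C"
  shows "X \<in> Cells C" "src C X = X" "tgt C X = X" "dom2 C X = X" "cod2 C X = X"
proof -
  show 1: "X \<in> Cells C" and 2: "src C X = X"
    using assms by (auto simp: Obj_def)
  show "tgt C X = X" using horizontal.target_source[OF 1] 2 by simp
  show 3: "dom2 C X = X" using dom_src[OF 1] 2 by simp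
  show "cod2 C X = X" using cod_arrow[OF 1 3] .
qed

lemma src_Obj: "a \<in> Cells C \<Longrightarrow> src C a \<in> Obj C"
  and tgt_Obj: "a \<in> Cells C \<Longrightarrow> tgt C a \<in> Obj C"
  by (simp_all add: Obj_def)

lemma homD:
  assumes "f \<in> hom C X Y"
  shows "f \<in> Cells C" "src C f = X" "tgt C f = Y" "dom2 C f = f" "cod2 C f = f"
  using assms cod_arrow[of f] by (auto simp: hom_def)

lemma two_homD:
  assumes "a \<in> two_hom C f g"
  shows "a \<in> Cells C" "dom2 C a = f" "cod2 C a = g"
  using assms by (auto simp: two_hom_def)

text \<open>The interchange law with identity 2-cells in two opposite corners. Comparing the two
  factorizations slides one 2-cell past another.\<close>

lemma exchange:
  assumes "a \<in> Cells C" "b \<in> Cells C" "tgt C a = src C b"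
  shows "(a \<star> dom2 C b) \<bullet> (cod2 C a \<star> b) = a \<star> b"
    and "(dom2 C a \<star> b) \<bullet> (a \<star> cod2 C b) = a \<star> b"
  using assms interchange[of a "cod2 C a" "dom2 C b" b] interchange[of "dom2 C a" a b "cod2 C b"]
  by simp_all

lemma whisker_left_vcomp:
  assumes "f \<in> Cells C" "dom2 C f = f" "a \<in> Cells C" "b \<in> Cells C"
    "cod2 C a = dom2 C b" "tgt C f = src C a"
  shows "f \<star> (a \<bullet> b) = (f \<star> a) \<bullet> (f \<star> b)"
  using assms cod_arrow[of f] interchange[of f f a b] vertical.comp_unit_left[of f] by simp

lemma whisker_right_vcomp:
  assumes "f \<in> Cells C" "dom2 C f = f" "a \<in> Cells C" "b \<in> Cells C"
    "cod2 C a = dom2 C b" "tgt C a = src C f"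
  shows "(a \<bullet> b) \<star> f = (a \<star> f) \<bullet> (b \<star> f)"
  using assms cod_arrow[of f] interchange[of a b f f] vertical.comp_unit_left[of f] by simp

section \<open>Invertible 2-cells\<close>

definition invertible :: "'c \<Rightarrow> bool" where
  "invertible a \<longleftrightarrow> a \<in> Cells C \<and> (\<exists>b \<in> Cells C. dom2 C b = cod2 C a \<and> cod2 C b = dom2 C a \<and>
     a \<bullet> b = dom2 C a \<and> b \<bullet> a = cod2 C a)"

lemma invertibleI:
  assumes "a \<in> Cells C" "b \<in> Cells C" "dom2 C b = cod2 C a" "cod2 C b = dom2 C a"
    "a \<bullet> b = dom2 C a" "b \<bullet> a = cod2 C a"
  shows "invertible a"
  using assms by (auto simp: invertible_def)

lemma invertibleE:
  assumes "invertible a"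
  obtains b where "b \<in> Cells C" "dom2 C b = cod2 C a" "cod2 C b = dom2 C a"
    "a \<bullet> b = dom2 C a" "b \<bullet> a = cod2 C a" "invertible b"
  using assms by (auto simp: invertible_def)

text \<open>\<open>invertible\<close> reads the boundaries off the cell itself, so invertibility can
  be passed along composites and functors without naming them.\<close>

lemma inv_two_hom_iff: "a \<in> inv_two_hom C f g \<longleftrightarrow> invertible a \<and> dom2 C a = f \<and> cod2 C a = g"
  by (auto simp: inv_two_hom_def two_hom_def invertible_def)

lemma inv_two_homD:
  assumes "a \<in> inv_two_hom C f g"
  shows "a \<in> Cells C" "dom2 C a = f" "cod2 C a = g" "invertible a"
  using assms by (auto simp: inv_two_hom_iff invertible_def)

lemma invertible_cancel_left:
  assumes a: "invertible a" and bc: "b \<in> Cells C" "c \<in> Cells C"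
    "cod2 C a = dom2 C b" "cod2 C a = dom2 C c" and eq: "a \<bullet> b = a \<bullet> c"
  shows "b = c"
proof -
  have ac: "a \<in> Cells C" using a by (simp add: invertible_def)
  obtain a' where a': "a' \<in> Cells C" "dom2 C a' = cod2 C a" "cod2 C a' = dom2 C a"
    "a \<bullet> a' = dom2 C a" "a' \<bullet> a = cod2 C a" using a by (rule invertibleE)
  have "a' \<bullet> a \<bullet> b = a' \<bullet> a \<bullet> c"
    using ac a'(1-3) bc eq by (simp add: vertical.comp_assoc)
  then show ?thesis using a'(5) bc vertical.comp_unit_left by metis
qed

lemma invertible_cancel_right:
  assumes a: "invertible a" and bc: "b \<in> Cells C" "c \<in> Cells C"
    "cod2 C b = dom2 C a" "cod2 C c = dom2 C a" and eq: "b \<bullet> a = c \<bullet> a"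
  shows "b = c"
proof -
  have ac: "a \<in> Cells C" using a by (simp add: invertible_def)
  obtain a' where a': "a' \<in> Cells C" "dom2 C a' = cod2 C a" "cod2 C a' = dom2 C a"
    "a \<bullet> a' = dom2 C a" "a' \<bullet> a = cod2 C a" using a by (rule invertibleE)
  have "b \<bullet> (a \<bullet> a') = c \<bullet> (a \<bullet> a')"
    using ac a'(1-3) bc eq by (simp flip: vertical.comp_assoc)
  then show ?thesis using a'(4) bc vertical.comp_unit_right by metis
qed

lemma invertible_vcomp:
  assumes "invertible a" "invertible b" "cod2 C a = dom2 C b"
  shows "invertible (a \<bullet> b)"
proof -
  have ab: "a \<in> Cells C" "b \<in> Cells C" using assms by (simp_all add: invertible_def)
  obtain a' where a': "a' \<in> Cells C" "dom2 C a' = cod2 C a" "cod2 C a' = dom2 C a"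
    "a \<bullet> a' = dom2 C a" "a' \<bullet> a = cod2 C a" using assms(1) by (rule invertibleE)
  obtain b' where b': "b' \<in> Cells C" "dom2 C b' = cod2 C b" "cod2 C b' = dom2 C b"
    "b \<bullet> b' = dom2 C b" "b' \<bullet> b = cod2 C b" using assms(2) by (rule invertibleE)
  have "b \<bullet> (b' \<bullet> a') = a'"
    using ab a' b' assms(3) vertical.comp_assoc[of b b' a'] vertical.comp_unit_left[of a'] by simp
  moreover have "a' \<bullet> (a \<bullet> b) = b"
    using ab a' b' assms(3) vertical.comp_assoc[of a' a b] vertical.comp_unit_left[of b] by simp
  ultimately have "(a \<bullet> b) \<bullet> (b' \<bullet> a') = dom2 C a" "(b' \<bullet> a') \<bullet> (a \<bullet> b) = cod2 C b"
    using ab a' b' assms(3) by (simp_all add: vertical.comp_assoc)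
  then show ?thesis
    unfolding invertible_def using ab a' b' assms(3) by (intro conjI bexI[of _ "b' \<bullet> a'"]) simp_all
qed

lemma invertible_whisker_right:
  assumes a: "invertible a" and f: "f \<in> Cells C" "dom2 C f = f" "tgt C a = src C f"
  shows "invertible (a \<star> f)"
proof -
  have ac: "a \<in> Cells C" using a by (simp add: invertible_def)
  obtain a' where a': "a' \<in> Cells C" "dom2 C a' = cod2 C a" "cod2 C a' = dom2 C a"
    "a \<bullet> a' = dom2 C a" "a' \<bullet> a = cod2 C a" using a by (rule invertibleE)
  have t: "tgt C a' = src C f"
    using tgt_dom[OF a'(1)] a'(2) tgt_cod[OF ac] f by simp
  have "(a \<star> f) \<bullet> (a' \<star> f) = dom2 C a \<star> f" "(a' \<star> f) \<bullet> (a \<star> f) = cod2 C a \<star> f"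
    using whisker_right_vcomp[of f a a'] whisker_right_vcomp[of f a' a] ac a' f t by simp_all
  then show ?thesis
    unfolding invertible_def using ac a' f t cod_arrow[OF f(1,2)]
    by (intro conjI bexI[of _ "a' \<star> f"]) simp_all
qed

section \<open>Whiskering by equi-arrows\<close>

lemma equi_arrowE:
  assumes "equi_arrow C f A B"
  obtains g e where "equi_arrow C g B A" "invertible e" "dom2 C e = g \<star> f" "cod2 C e = B"
proof -
  obtain g where g: "g \<in> hom C B A"
    and ne: "inv_two_hom C (f \<star> g) A \<noteq> {}" "inv_two_hom C (g \<star> f) B \<noteq> {}"
    using assms by (auto simp: equi_arrow_def)
  then have "equi_arrow C g B A" using assms by (auto simp: equi_arrow_def)
  moreover obtain e where "e \<in> inv_two_hom C (g \<star> f) B" using ne(2) by blast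
  ultimately show thesis using that[of g e] by (simp add: inv_two_hom_iff)
qed

lemma equi_arrowD:
  assumes "equi_arrow C f A B"
  shows "f \<in> Cells C" "src C f = A" "tgt C f = B" "dom2 C f = f" "cod2 C f = f"
  using assms homD[of f A B] by (auto simp: equi_arrow_def)

text \<open>One invertible cell \<open>e\<close> from \<open>g \<star> f\<close> to the identity
  arrow does the work: exchanging it with a cell \<open>x\<close> expresses \<open>x\<close> through
  \<open>g \<star> (f \<star> x)\<close> up to invertible whiskerings of \<open>e\<close>, so
  \<open>f \<star> x\<close> determines \<open>x\<close>.\<close>

lemma whisker_equi_faithful:
  assumes f: "equi_arrow C f A B" and a: "a \<in> Cells C" "src C a = B" and b: "b \<in> Cells C"
    and d: "dom2 C a = dom2 C b" "cod2 C a = cod2 C b" and eq: "f \<star> a = f \<star> b"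
  shows "a = b"
proof -
  obtain g e where ge: "equi_arrow C g B A" "invertible e" "dom2 C e = g \<star> f" "cod2 C e = B"
    using f by (rule equi_arrowE)
  note F = equi_arrowD[OF f] and G = equi_arrowD[OF ge(1)]
  have e: "e \<in> Cells C" using ge(2) by (simp add: invertible_def)
  have tB: "tgt C B = B" using F by (metis horizontal.target_target)
  have se: "tgt C e = B" using tgt_cod[OF e] ge(4) tB by simp
  have sb: "src C b = B" using a b d by (metis src_dom)
  have uB: "B \<star> x = x" if "x \<in> Cells C" "src C x = B" for x
    using that horizontal.comp_unit_left[of x] by simp
  have *: "(g \<star> (f \<star> x)) \<bullet> (e \<star> cod2 C x) = (e \<star> dom2 C x) \<bullet> x"
    if "x \<in> Cells C" "src C x = B" for x
    using exchange[of e x] that e se ge F G uB horizontal.comp_assoc[of g f x] by simp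
  have "(e \<star> dom2 C a) \<bullet> a = (e \<star> dom2 C a) \<bullet> b"
    using *[of a] *[of b] a b sb d eq by simp
  moreover have "invertible (e \<star> dom2 C a)"
    using ge(2) a se by (intro invertible_whisker_right) simp_all
  ultimately show ?thesis
    by (rule invertible_cancel_left[rotated -1]) (use a b sb d ge e se uB in simp_all)
qed

text \<open>The same exchange prescribes the preimage, but it only shows that
  \<open>f \<star> a\<close> and \<open>p\<close> agree after whiskering by \<open>g\<close>. The
  pseudo-inverse \<open>g\<close> is an equi-arrow too, so faithfulness removes it.\<close>

lemma whisker_equi_full:
  assumes f: "equi_arrow C f A B" and u: "u \<in> Cells C" "dom2 C u = u" "src C u = B"
    and v: "v \<in> Cells C" "dom2 C v = v" "src C v = B"
    and p: "p \<in> Cells C" "dom2 C p = f \<star> u" "cod2 C p = f \<star> v"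
  obtains a where "a \<in> Cells C" "dom2 C a = u" "cod2 C a = v" "f \<star> a = p"
proof -
  obtain g e where ge: "equi_arrow C g B A" "invertible e" "dom2 C e = g \<star> f" "cod2 C e = B"
    using f by (rule equi_arrowE)
  note F = equi_arrowD[OF f] and G = equi_arrowD[OF ge(1)]
  have e: "e \<in> Cells C" using ge(2) by (simp add: invertible_def)
  have tB: "tgt C B = B" using F by (metis horizontal.target_target)
  have se: "tgt C e = B" using tgt_cod[OF e] ge(4) tB by simp
  have uB: "B \<star> x = x" if "x \<in> Cells C" "src C x = B" for x
    using that horizontal.comp_unit_left[of x] by simp
  have cu: "cod2 C u = u" "cod2 C v = v" using u v by (simp_all add: cod_arrow)
  have sp: "src C p = A" using src_dom[OF p(1)] p F u by simp
  have inv: "invertible (e \<star> u)" "invertible (e \<star> v)"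
    using ge(2) u v se by (auto intro!: invertible_whisker_right)
  obtain k where k: "k \<in> Cells C" "dom2 C k = u" "cod2 C k = g \<star> (f \<star> u)" "(e \<star> u) \<bullet> k = g \<star> (f \<star> u)"
    using inv(1) by (rule invertibleE) (use u e se cu ge uB F G horizontal.comp_assoc[of g f u] in auto)
  \<comment> \<open>\<open>k\<close> is the inverse of \<open>e \<star> u\<close>; thus
    \<open>a\<close> is \<open>g \<star> p\<close> conjugated by \<open>e\<close>.\<close>
  define a where "a = k \<bullet> ((g \<star> p) \<bullet> (e \<star> v))"
  have gp: "g \<star> p \<in> Cells C" "dom2 C (g \<star> p) = g \<star> (f \<star> u)" "cod2 C (g \<star> p) = g \<star> (f \<star> v)"
    using p G sp by simp_all
  have ev: "e \<star> v \<in> Cells C" "dom2 C (e \<star> v) = g \<star> (f \<star> v)" "cod2 C (e \<star> v) = v"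
    "e \<star> u \<in> Cells C" "dom2 C (e \<star> u) = g \<star> (f \<star> u)" "cod2 C (e \<star> u) = u"
    using e v u se cu ge uB F G by (simp_all add: horizontal.comp_assoc)
  have a: "a \<in> Cells C" "dom2 C a = u" "cod2 C a = v"
    unfolding a_def using k gp ev by simp_all
  have sa: "src C a = B" using src_dom[OF a(1)] a(2) u by simp
  have "(g \<star> (f \<star> a)) \<bullet> (e \<star> v) = (e \<star> u) \<bullet> a"
    using exchange[of e a] a sa e se ge F G uB horizontal.comp_assoc[of g f a] by simp
  also have "\<dots> = ((e \<star> u) \<bullet> k) \<bullet> ((g \<star> p) \<bullet> (e \<star> v))"
    unfolding a_def using vertical.comp_assoc[of "e \<star> u" k "(g \<star> p) \<bullet> (e \<star> v)"] k gp ev by simp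
  also have "\<dots> = (g \<star> p) \<bullet> (e \<star> v)"
    using k gp ev vertical.comp_unit_left[of "(g \<star> p) \<bullet> (e \<star> v)"] by simp
  finally have "g \<star> (f \<star> a) = g \<star> p"
    by (rule invertible_cancel_right[OF inv(2), rotated -1]) (use gp ev a sa F G in simp_all)
  then have "f \<star> a = p"
    by (rule whisker_equi_faithful[OF ge(1), rotated -1]) (use p F sa a sp in simp_all)
  with a that show thesis by blast
qed

end

text \<open>Reversing the arrows transports facts on left whiskering to right whiskering.\<close>

definition op1 :: "('c, 'm) two_cat_scheme \<Rightarrow> ('c, 'm) two_cat_scheme" where
  "op1 C = C\<lparr>src := tgt C, tgt := src C, hcomp := \<lambda>a b. hcomp C b a\<rparr>"

lemma op1_simps [simp]:
  "Cells (op1 C) = Cells C" "src (op1 C) = tgt C" "tgt (op1 C) = src C"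
  "dom2 (op1 C) = dom2 C" "cod2 (op1 C) = cod2 C" "vcomp (op1 C) = vcomp C"
  "hcomp (op1 C) = (\<lambda>a b. hcomp C b a)"
  by (simp_all add: op1_def)

context two_category
begin

lemma two_category_op1: "two_category (op1 C)"
  by unfold_locales
    (simp_all add: horizontal.comp_assoc vertical.comp_assoc interchange)

lemma equi_arrow_op1: "equi_arrow C f A B \<Longrightarrow> equi_arrow (op1 C) f B A"
  by (auto simp: equi_arrow_def hom_def inv_two_hom_def two_hom_def)

lemma whisker_right_equi_faithful:
  assumes "equi_arrow C f A B" "a \<in> Cells C" "tgt C a = A" "b \<in> Cells C"
    "dom2 C a = dom2 C b" "cod2 C a = cod2 C b" "a \<star> f = b \<star> f"
  shows "a = b"
  using two_category.whisker_equi_faithful[OF two_category_op1 equi_arrow_op1[OF assms(1)]] assms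
  by simp

lemma whisker_right_equi_full:
  assumes "equi_arrow C f A B" "u \<in> Cells C" "dom2 C u = u" "tgt C u = A"
    "v \<in> Cells C" "dom2 C v = v" "tgt C v = A"
    "p \<in> Cells C" "dom2 C p = u \<star> f" "cod2 C p = v \<star> f"
  obtains a where "a \<in> Cells C" "dom2 C a = u" "cod2 C a = v" "a \<star> f = p"
  using two_category.whisker_equi_full[OF two_category_op1 equi_arrow_op1[OF assms(1)]] assms
  by (metis op1_simps)

end

section \<open>Strict 2-functors and those equivalent to the identity\<close>

lemma strict_two_functorD:
  assumes "strict_two_functor C D F"
  shows "a \<in> Cells C \<Longrightarrow> F a \<in> Cells D"
    and "a \<in> Cells C \<Longrightarrow> src D (F a) = F (src C a)"
    and "a \<in> Cells C \<Longrightarrow> tgt D (F a) = F (tgt C a)"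
    and "a \<in> Cells C \<Longrightarrow> dom2 D (F a) = F (dom2 C a)"
    and "a \<in> Cells C \<Longrightarrow> cod2 D (F a) = F (cod2 C a)"
    and "\<lbrakk>a \<in> Cells C; b \<in> Cells C; tgt C a = src C b\<rbrakk> \<Longrightarrow> F (a \<star>\<^bsub>C\<^esub> b) = F a \<star>\<^bsub>D\<^esub> F b"
    and "\<lbrakk>a \<in> Cells C; b \<in> Cells C; cod2 C a = dom2 C b\<rbrakk> \<Longrightarrow> F (a \<bullet>\<^bsub>C\<^esub> b) = F a \<bullet>\<^bsub>D\<^esub> F b"
  using assms by (auto simp: strict_two_functor_def)

context two_category
begin

lemma functor_invertible:
  assumes "strict_two_functor C C F" "invertible a"
  shows "invertible (F a)"
proof -
  note F = strict_two_functorD[OF assms(1)]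
  have "a \<in> Cells C" using assms(2) by (simp add: invertible_def)
  moreover obtain a' where "a' \<in> Cells C" "dom2 C a' = cod2 C a" "cod2 C a' = dom2 C a"
    "a \<bullet> a' = dom2 C a" "a' \<bullet> a = cod2 C a" using assms(2) by (rule invertibleE)
  ultimately show ?thesis
    unfolding invertible_def using F(7)[of a a'] F(7)[of a' a]
    by (intro conjI bexI[of _ "F a'"]) (simp_all add: F(1-5))
qed

lemma functor_equi_arrow:
  assumes "strict_two_functor C C F" "equi_arrow C f A B"
  shows "equi_arrow C (F f) (F A) (F B)"
proof -
  note F = strict_two_functorD[OF assms(1)]
  have hom: "F h \<in> hom C (F X) (F Y)" if "h \<in> hom C X Y" for h X Y
    using homD[OF that] by (simp add: hom_def F)
  obtain g where g: "g \<in> hom C B A"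
    and ne: "inv_two_hom C (f \<star> g) A \<noteq> {}" "inv_two_hom C (g \<star> f) B \<noteq> {}" and f: "f \<in> hom C A B"
    using assms(2) by (auto simp: equi_arrow_def)
  have inv: "inv_two_hom C (F h \<star> F k) (F X) \<noteq> {}"
    if ne: "inv_two_hom C (h \<star> k) X \<noteq> {}" and hk: "h \<in> hom C X Y" "k \<in> hom C Y X" for h k X Y
  proof -
    obtain e where e: "e \<in> inv_two_hom C (h \<star> k) X" using ne by blast
    have "F e \<in> inv_two_hom C (F h \<star> F k) (F X)"
      using inv_two_homD[OF e] homD[OF hk(1)] homD[OF hk(2)] functor_invertible[OF assms(1)]
        F(4,5)[of e] F(6)[of h k]
      by (simp add: inv_two_hom_iff)
    then show ?thesis by blast
  qed
  show ?thesis
    unfolding equi_arrow_def using hom f g inv[OF ne(1) f g] inv[OF ne(2) g f] by blast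
qed

end

text \<open>Conjugating by the components identifies \<open>F\<close> with the identity on hom categories.\<close>

locale equivalent_to_identity = two_category C
  for C :: "('c, 'm) two_cat_scheme" (structure) +
  fixes F t n :: "'c \<Rightarrow> 'c"
  assumes is_functor: "strict_two_functor C C F"
    and natural: "pseudo_natural C C F (\<lambda>a. a) t n"
    and component_equi: "X \<in> Obj C \<Longrightarrow> equi_arrow C (t X) (F X) X"
begin

lemma component:
  assumes "X \<in> Obj C"
  shows "t X \<in> Cells C" "src C (t X) = F X" "tgt C (t X) = X" "dom2 C (t X) = t X"
    "cod2 C (t X) = t X"
  using equi_arrowD[OF component_equi[OF assms]] .

lemma naturality_cell:
  assumes "f \<in> Cells C" "dom2 C f = f"
  shows "n f \<in> Cells C" "dom2 C (n f) = F f \<star> t (tgt C f)" "cod2 C (n f) = t (src C f) \<star> f"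
    "invertible (n f)"
proof -
  have "f \<in> hom C (src C f) (tgt C f)" using assms by (simp add: hom_def)
  then have "n f \<in> inv_two_hom C (F f \<star> t (tgt C f)) (t (src C f) \<star> f)"
    using natural src_Obj[of f] tgt_Obj[of f] assms unfolding pseudo_natural_def by blast
  then show "n f \<in> Cells C" "dom2 C (n f) = F f \<star> t (tgt C f)" "cod2 C (n f) = t (src C f) \<star> f"
    "invertible (n f)"
    by (simp_all add: inv_two_homD)
qed

lemma naturality_Obj: "X \<in> Obj C \<Longrightarrow> n X = t X"
  using natural unfolding pseudo_natural_def by blast

lemma naturality:
  assumes "a \<in> Cells C"
  shows "(F a \<star> t (tgt C a)) \<bullet> n (cod2 C a) = n (dom2 C a) \<bullet> (t (src C a) \<star> a)"
proof -
  have "dom2 C a \<in> hom C (src C a) (tgt C a)" "cod2 C a \<in> hom C (src C a) (tgt C a)"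
    "a \<in> two_hom C (dom2 C a) (cod2 C a)"
    using assms by (simp_all add: hom_def two_hom_def)
  then show ?thesis
    using natural src_Obj[OF assms] tgt_Obj[OF assms] unfolding pseudo_natural_def by blast
qed

text \<open>Naturality at a 2-cell \<open>a\<close> determines \<open>t \<star> a\<close> from
  \<open>F a\<close>, since the naturality 2-cells are invertible; the component \<open>t\<close> is
  then cancelled as an equi-arrow.\<close>

lemma faithful:
  assumes a: "a \<in> Cells C" and b: "b \<in> Cells C"
    and d: "dom2 C a = dom2 C b" "cod2 C a = cod2 C b" and eq: "F a = F b"
  shows "a = b"
proof -
  have s: "src C a = src C b" "tgt C a = tgt C b"
    using a b d by (metis src_dom, metis tgt_dom)
  note T = component[OF src_Obj[OF b]] component[OF tgt_Obj[OF b]]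
  note n = naturality_cell[of "dom2 C b"]
  have "n (dom2 C b) \<bullet> (t (src C b) \<star> a) = n (dom2 C b) \<bullet> (t (src C b) \<star> b)"
    using naturality[OF a] naturality[OF b] d s eq by simp
  then have "t (src C b) \<star> a = t (src C b) \<star> b"
    by (rule invertible_cancel_left[OF n(4), rotated -1]) (use a b d s T n in simp_all)
  then show ?thesis
    by (rule whisker_equi_faithful[OF component_equi[OF src_Obj[OF b]], rotated -1])
      (use a b d s in simp_all)
qed

text \<open>Fullness of left whiskering by a component produces the preimage, and faithfulness of
  right whiskering by the other component identifies its image with \<open>p\<close>.\<close>

lemma full:
  assumes f: "f \<in> Cells C" "dom2 C f = f" and g: "g \<in> Cells C" "dom2 C g = g"
    and s: "src C g = src C f" "tgt C g = tgt C f"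
    and p: "p \<in> Cells C" "dom2 C p = F f" "cod2 C p = F g"
  obtains a where "a \<in> Cells C" "dom2 C a = f" "cod2 C a = g" "F a = p"
proof -
  note F = strict_two_functorD[OF is_functor]
  note c = cod_arrow[OF f] cod_arrow[OF g]
  note T = component[OF src_Obj[OF f(1)]] component[OF tgt_Obj[OF f(1)]]
  note nf = naturality_cell[OF f] and ng = naturality_cell[OF g]
  obtain m where m: "m \<in> Cells C" "dom2 C m = cod2 C (n f)" "cod2 C m = dom2 C (n f)"
    "n f \<bullet> m = dom2 C (n f)" "m \<bullet> n f = cod2 C (n f)"
    using nf(4) by (rule invertibleE)
  have sp: "src C p = F (src C f)" "tgt C p = F (tgt C f)"
    using src_dom[OF p(1)] tgt_dom[OF p(1)] p(2) F(2,3)[OF f(1)] by simp_all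
  \<comment> \<open>With \<open>m\<close> inverse to \<open>n f\<close>, the naturality equation
    forces this value of \<open>t (src C f) \<star> a\<close> for every preimage \<open>a\<close> of
    \<open>p\<close>.\<close>
  let ?q = "m \<bullet> ((p \<star> t (tgt C f)) \<bullet> n g)"
  have q1: "(p \<star> t (tgt C f)) \<bullet> n g \<in> Cells C"
    "dom2 C ((p \<star> t (tgt C f)) \<bullet> n g) = F f \<star> t (tgt C f)"
    "cod2 C ((p \<star> t (tgt C f)) \<bullet> n g) = t (src C f) \<star> g"
    using p sp T ng s by simp_all
  have q: "?q \<in> Cells C" "dom2 C ?q = t (src C f) \<star> f" "cod2 C ?q = t (src C f) \<star> g"
    using q1 m nf by simp_all
  obtain a where a: "a \<in> Cells C" "dom2 C a = f" "cod2 C a = g" "t (src C f) \<star> a = ?q"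
    using component_equi[OF src_Obj[OF f(1)]] f(1,2) refl g s(1) q by (rule whisker_equi_full)
  have sa: "src C a = src C f" "tgt C a = tgt C f"
    using src_dom[OF a(1)] tgt_dom[OF a(1)] a(2) by simp_all
  have "(F a \<star> t (tgt C f)) \<bullet> n g = n f \<bullet> ?q"
    using naturality[OF a(1)] a sa by simp
  also have "\<dots> = (p \<star> t (tgt C f)) \<bullet> n g"
    using vertical.comp_assoc[of "n f" m "(p \<star> t (tgt C f)) \<bullet> n g"] m nf q1
      vertical.comp_unit_left[OF q1(1)] by simp
  finally have "F a \<star> t (tgt C f) = p \<star> t (tgt C f)"
    by (rule invertible_cancel_right[OF ng(4), rotated -1])
      (use a sa p sp T ng s F[of a] in simp_all)
  then have "F a = p"
    by (rule whisker_right_equi_faithful[OF component_equi[OF tgt_Obj[OF f(1)]], rotated -1])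
      (use a sa p sp F in simp_all)
  with a that show thesis by blast
qed

text \<open>The inverse is lifted as well; both composites are sent to identities and hence are
  identities by faithfulness. This yields the invertibility of \<open>Kl\<close>, through which
  \<open>X \<otimes> L Y\<close> becomes cancellable.\<close>

lemma full_invertible:
  assumes f: "f \<in> Cells C" "dom2 C f = f" and g: "g \<in> Cells C" "dom2 C g = g"
    and s: "src C g = src C f" "tgt C g = tgt C f"
    and p: "invertible p" "dom2 C p = F f" "cod2 C p = F g"
  obtains a where "invertible a" "dom2 C a = f" "cod2 C a = g" "F a = p"
proof -
  note F = strict_two_functorD[OF is_functor]
  have pc: "p \<in> Cells C" using p(1) by (simp add: invertible_def)
  obtain p' where p': "p' \<in> Cells C" "dom2 C p' = cod2 C p" "cod2 C p' = dom2 C p"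
    "p \<bullet> p' = dom2 C p" "p' \<bullet> p = cod2 C p" using p(1) by (rule invertibleE)
  obtain a where a: "a \<in> Cells C" "dom2 C a = f" "cod2 C a = g" "F a = p"
    using full[OF f g s pc p(2,3)] by blast
  obtain b where b: "b \<in> Cells C" "dom2 C b = g" "cod2 C b = f" "F b = p'"
    by (rule full[OF g f s[symmetric] p'(1)]) (simp_all add: p' p)
  have "F (a \<bullet> b) = F f" "F (b \<bullet> a) = F g"
    using F(7)[of a b] F(7)[of b a] a b p p' by simp_all
  then have "a \<bullet> b = f" "b \<bullet> a = g"
    using faithful[of "a \<bullet> b" f] faithful[of "b \<bullet> a" g] a b f g cod_arrow[of f] cod_arrow[of g]
    by simp_all
  then have "invertible a" using a b by (simp add: invertibleI)
  with a that show thesis by blast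
qed

end

section \<open>Calculus of the tensor product\<close>

context semi_monoidal_two_category
begin

lemma tensor_simps [simp]:
  assumes "a \<in> Cells C" "b \<in> Cells C"
  shows "a \<otimes> b \<in> Cells C"
    and "src C (a \<otimes> b) = src C a \<otimes> src C b"
    and "tgt C (a \<otimes> b) = tgt C a \<otimes> tgt C b"
    and "dom2 C (a \<otimes> b) = dom2 C a \<otimes> dom2 C b"
    and "cod2 C (a \<otimes> b) = cod2 C a \<otimes> cod2 C b"
  using assms strict_two_functorD(1-5)[OF tensor_two_functor, of "(a, b)"]
  by (simp_all add: prod_two_cat_def)

lemma tensor_hcomp:
  assumes "a \<in> Cells C" "b \<in> Cells C" "tgt C a = src C b"
    "a' \<in> Cells C" "b' \<in> Cells C" "tgt C a' = src C b'"
  shows "(a \<star> b) \<otimes> (a' \<star> b') = (a \<otimes> a') \<star> (b \<otimes> b')"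
  using assms strict_two_functorD(6)[OF tensor_two_functor, of "(a, a')" "(b, b')"]
  by (simp add: prod_two_cat_def)

lemma tensor_vcomp:
  assumes "a \<in> Cells C" "b \<in> Cells C" "cod2 C a = dom2 C b"
    "a' \<in> Cells C" "b' \<in> Cells C" "cod2 C a' = dom2 C b'"
  shows "(a \<bullet> b) \<otimes> (a' \<bullet> b') = (a \<otimes> a') \<bullet> (b \<otimes> b')"
  using assms strict_two_functorD(7)[OF tensor_two_functor, of "(a, a')" "(b, b')"]
  by (simp add: prod_two_cat_def)

lemma tensor_Obj: "\<lbrakk>X \<in> Obj C; Y \<in> Obj C\<rbrakk> \<Longrightarrow> X \<otimes> Y \<in> Obj C"
  by (simp add: Obj_def)

text \<open>An object is its own identity arrow and identity 2-cell, so it is idempotent for both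
  compositions and can be held fixed in one variable. Invertible cells and equi-arrows are then
  preserved by the general facts on strict 2-functors.\<close>

lemma tensor_functors:
  assumes "X \<in> Obj C"
  shows "strict_two_functor C C (\<lambda>a. X \<otimes> a)" "strict_two_functor C C (\<lambda>a. a \<otimes> X)"
  unfolding strict_two_functor_def
  using ObjD[OF assms] tensor_hcomp[of X X] tensor_hcomp[of _ _ X X] tensor_vcomp[of X X]
    tensor_vcomp[of _ _ X X] horizontal.comp_unit_left[of X] vertical.comp_unit_left[of X]
  by simp_all

lemmas tensor_left = strict_two_functorD(6,7)[OF tensor_functors(1)]
  and tensor_right = strict_two_functorD(6,7)[OF tensor_functors(2)]

text \<open>Functoriality in two variables lets cells in different tensor factors slide past each
  other. For arrows it is the silent equality of \<rho>_X I Y # X \<lambda>_Y with X I \<lambda>_Y #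
  \<rho>_X Y inside condition (i).\<close>

lemma exchange_tensor:
  assumes "a \<in> Cells C" "b \<in> Cells C"
  shows "(a \<otimes> src C b) \<star> (tgt C a \<otimes> b) = a \<otimes> b"
    and "(src C a \<otimes> b) \<star> (a \<otimes> tgt C b) = a \<otimes> b"
  using assms tensor_hcomp[of a "tgt C a" "src C b" b] tensor_hcomp[of "src C a" a b "tgt C b"]
  by simp_all

end

section \<open>The data on \<open>I\<close> and the induced cells \<open>Kl\<close>,
  \<open>Kr\<close> and \<open>N\<close>\<close>

locale tensor_with_unit = semi_monoidal_two_category C
  for C :: "('c, 'm) tensor_two_cat_scheme" (structure) +
  fixes I :: 'c and lam lam_nat rho rho_nat :: "'c \<Rightarrow> 'c" and K :: "'c \<Rightarrow> 'c \<Rightarrow> 'c"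
  assumes I_Obj: "I \<in> Obj C"
    and lam_natural: "pseudo_natural C C (\<lambda>a. I \<otimes> a) (\<lambda>a. a) lam lam_nat"
    and rho_natural: "pseudo_natural C C (\<lambda>a. a \<otimes> I) (\<lambda>a. a) rho rho_nat"
    and lam_equi: "X \<in> Obj C \<Longrightarrow> equi_arrow C (lam X) (I \<otimes> X) X"
    and rho_equi: "X \<in> Obj C \<Longrightarrow> equi_arrow C (rho X) (X \<otimes> I) X"
    and K_invertible: "\<lbrakk>X \<in> Obj C; Y \<in> Obj C\<rbrakk> \<Longrightarrow> K X Y \<in> inv_two_hom C (X \<otimes> lam Y) (rho X \<otimes> Y)"
    and K_natural: "natural_K C I lam lam_nat rho rho_nat K"
begin

text \<open>The two instances provide full faithfulness of tensoring with \<open>I\<close> on either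
  side, the form of cancellability from which \<open>Kl\<close> and \<open>Kr\<close> are
  built.\<close>

sublocale lam: equivalent_to_identity C "\<lambda>a. I \<otimes> a" lam lam_nat
  by unfold_locales (simp_all add: I_Obj tensor_functors lam_natural lam_equi)

sublocale rho: equivalent_to_identity C "\<lambda>a. a \<otimes> I" rho rho_nat
  by unfold_locales (simp_all add: I_Obj tensor_functors rho_natural rho_equi)

abbreviation "Kl \<equiv> K_left C I lam K"
abbreviation "Kr \<equiv> K_right C I rho K"
abbreviation "N \<equiv> N_left C I lam lam_nat"

lemma I_simps [simp]: "I \<in> Cells C" "src C I = I" "tgt C I = I" "dom2 C I = I" "cod2 C I = I"
  using ObjD[OF I_Obj] .

lemma K_cell:
  assumes "X \<in> Obj C" "Y \<in> Obj C"
  shows "K X Y \<in> Cells C" "dom2 C (K X Y) = X \<otimes> lam Y" "cod2 C (K X Y) = rho X \<otimes> Y"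
    "invertible (K X Y)" "src C (K X Y) = X \<otimes> (I \<otimes> Y)" "tgt C (K X Y) = X \<otimes> Y"
proof -
  show 1: "K X Y \<in> Cells C" "dom2 C (K X Y) = X \<otimes> lam Y" "cod2 C (K X Y) = rho X \<otimes> Y"
    "invertible (K X Y)"
    using inv_two_homD[OF K_invertible[OF assms]] .
  show "src C (K X Y) = X \<otimes> (I \<otimes> Y)" "tgt C (K X Y) = X \<otimes> Y"
    using src_dom[OF 1(1)] tgt_dom[OF 1(1)] 1(2) assms ObjD lam.component by simp_all
qed

text \<open>Inverting \<open>K I Y \<otimes> Z\<close> turns the defining equation into a
  prescription of \<open>I \<otimes> k\<close>, which has exactly one solution because
  \<open>I \<otimes> _\<close> is fully faithful.\<close>

lemma K_left:
  assumes "Y \<in> Obj C" "Z \<in> Obj C"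
  shows "Kl Y Z \<in> Cells C" "dom2 C (Kl Y Z) = lam (Y \<otimes> Z)" "cod2 C (Kl Y Z) = lam Y \<otimes> Z"
    "src C (Kl Y Z) = I \<otimes> (Y \<otimes> Z)" "tgt C (Kl Y Z) = Y \<otimes> Z" "invertible (Kl Y Z)"
    "(I \<otimes> Kl Y Z) \<bullet> (K I Y \<otimes> Z) = K I (Y \<otimes> Z)"
proof -
  note YZ = tensor_Obj[OF assms]
  note O = ObjD[OF assms(1)] ObjD[OF assms(2)] ObjD[OF YZ]
  note T = lam.component[OF assms(1)] lam.component[OF YZ] rho.component[OF I_Obj]
  note k1 = K_cell[OF I_Obj assms(1)] and k2 = K_cell[OF I_Obj YZ]
  have "invertible (K I Y \<otimes> Z)" by (rule functor_invertible[OF tensor_functors(2)[OF assms(2)] k1(4)])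
  then obtain m where m: "m \<in> Cells C" "dom2 C m = cod2 C (K I Y \<otimes> Z)" "cod2 C m = dom2 C (K I Y \<otimes> Z)"
    "K I Y \<otimes> Z \<bullet> m = dom2 C (K I Y \<otimes> Z)" "m \<bullet> (K I Y \<otimes> Z) = cod2 C (K I Y \<otimes> Z)" "invertible m"
    by (rule invertibleE)
  \<comment> \<open>\<open>m\<close> inverts \<open>K I Y \<otimes> Z\<close>, so this composite is
    the only possible value of \<open>I \<otimes> k\<close>.\<close>
  have p: "invertible (K I (Y \<otimes> Z) \<bullet> m)" "dom2 C (K I (Y \<otimes> Z) \<bullet> m) = I \<otimes> lam (Y \<otimes> Z)"
    "cod2 C (K I (Y \<otimes> Z) \<bullet> m) = I \<otimes> (lam Y \<otimes> Z)"
    using m k1 k2 O T by (auto intro!: invertible_vcomp simp: tensor_assoc)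
  obtain k where k: "invertible k" "dom2 C k = lam (Y \<otimes> Z)" "cod2 C k = lam Y \<otimes> Z"
    "I \<otimes> k = K I (Y \<otimes> Z) \<bullet> m"
    by (rule lam.full_invertible[OF _ _ _ _ _ _ p]) (use O T in \<open>simp_all add: tensor_assoc\<close>)
  have kc: "k \<in> Cells C" using k(1) by (simp add: invertible_def)
  have keq: "(I \<otimes> k) \<bullet> (K I Y \<otimes> Z) = K I (Y \<otimes> Z)"
    using k(4) m k1 k2 O T vertical.comp_assoc[of "K I (Y \<otimes> Z)" m "K I Y \<otimes> Z"]
      vertical.comp_unit_right[of "K I (Y \<otimes> Z)"]
    by (simp add: tensor_assoc)
  have "Kl Y Z = k"
    unfolding K_left_def
  proof (rule the_equality)
    show "k \<in> two_hom C (lam (Y \<otimes> Z)) (lam Y \<otimes> Z) \<and> (I \<otimes> k) \<bullet> (K I Y \<otimes> Z) = K I (Y \<otimes> Z)"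
      using k kc keq by (simp add: two_hom_def)
    fix k' assume k': "k' \<in> two_hom C (lam (Y \<otimes> Z)) (lam Y \<otimes> Z) \<and>
      (I \<otimes> k') \<bullet> (K I Y \<otimes> Z) = K I (Y \<otimes> Z)"
    note k'c = two_homD[OF conjunct1[OF k']]
    have "I \<otimes> k' = I \<otimes> k"
      by (rule invertible_cancel_right[OF \<open>invertible (K I Y \<otimes> Z)\<close>])
        (use k' k'c k(2,3) kc keq k1 O T in \<open>simp_all add: tensor_assoc\<close>)
    then show "k' = k"
      by (rule lam.faithful[rotated -1]) (use k'c k kc in simp_all)
  qed
  then show "Kl Y Z \<in> Cells C" "dom2 C (Kl Y Z) = lam (Y \<otimes> Z)" "cod2 C (Kl Y Z) = lam Y \<otimes> Z"
    "src C (Kl Y Z) = I \<otimes> (Y \<otimes> Z)" "tgt C (Kl Y Z) = Y \<otimes> Z" "invertible (Kl Y Z)"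
    "(I \<otimes> Kl Y Z) \<bullet> (K I Y \<otimes> Z) = K I (Y \<otimes> Z)"
    using k kc keq src_dom[OF kc] tgt_dom[OF kc] T by simp_all
qed

lemma K_right:
  assumes "X \<in> Obj C" "Y \<in> Obj C"
  shows "Kr X Y \<in> Cells C" "dom2 C (Kr X Y) = X \<otimes> rho Y" "cod2 C (Kr X Y) = rho (X \<otimes> Y)"
    "src C (Kr X Y) = X \<otimes> (Y \<otimes> I)" "tgt C (Kr X Y) = X \<otimes> Y"
    "(X \<otimes> K Y I) \<bullet> (Kr X Y \<otimes> I) = K (X \<otimes> Y) I"
proof -
  note XY = tensor_Obj[OF assms]
  note O = ObjD[OF assms(1)] ObjD[OF assms(2)] ObjD[OF XY]
  note T = rho.component[OF assms(2)] rho.component[OF XY] lam.component[OF I_Obj]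
  note k1 = K_cell[OF assms(2) I_Obj] and k2 = K_cell[OF XY I_Obj]
  have inv: "invertible (X \<otimes> K Y I)" by (rule functor_invertible[OF tensor_functors(1)[OF assms(1)] k1(4)])
  then obtain m where m: "m \<in> Cells C" "dom2 C m = cod2 C (X \<otimes> K Y I)" "cod2 C m = dom2 C (X \<otimes> K Y I)"
    "X \<otimes> K Y I \<bullet> m = dom2 C (X \<otimes> K Y I)" "m \<bullet> (X \<otimes> K Y I) = cod2 C (X \<otimes> K Y I)" "invertible m"
    by (rule invertibleE)
  \<comment> \<open>Here the known factor \<open>X \<otimes> K Y I\<close> stands on the left, so
    its inverse \<open>m\<close> is composed on the left, and the result is lifted along
    \<open>_ \<otimes> I\<close>.\<close>
  have p: "m \<bullet> K (X \<otimes> Y) I \<in> Cells C" "dom2 C (m \<bullet> K (X \<otimes> Y) I) = (X \<otimes> rho Y) \<otimes> I"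
    "cod2 C (m \<bullet> K (X \<otimes> Y) I) = rho (X \<otimes> Y) \<otimes> I"
    using m k1 k2 O T by (auto simp: tensor_assoc)
  obtain k where k: "k \<in> Cells C" "dom2 C k = X \<otimes> rho Y" "cod2 C k = rho (X \<otimes> Y)"
    "k \<otimes> I = m \<bullet> K (X \<otimes> Y) I"
    by (rule rho.full[OF _ _ _ _ _ _ p]) (use O T in \<open>simp_all add: tensor_assoc\<close>)
  have keq: "(X \<otimes> K Y I) \<bullet> (k \<otimes> I) = K (X \<otimes> Y) I"
    using k(4) m k1 k2 O T vertical.comp_assoc[of "X \<otimes> K Y I" m "K (X \<otimes> Y) I"]
      vertical.comp_unit_left[of "K (X \<otimes> Y) I"]
    by (simp add: tensor_assoc)
  have "Kr X Y = k"
    unfolding K_right_def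
  proof (rule the_equality)
    show "k \<in> two_hom C (X \<otimes> rho Y) (rho (X \<otimes> Y)) \<and> (X \<otimes> K Y I) \<bullet> (k \<otimes> I) = K (X \<otimes> Y) I"
      using k keq by (simp add: two_hom_def)
    fix k' assume k': "k' \<in> two_hom C (X \<otimes> rho Y) (rho (X \<otimes> Y)) \<and>
      (X \<otimes> K Y I) \<bullet> (k' \<otimes> I) = K (X \<otimes> Y) I"
    note k'c = two_homD[OF conjunct1[OF k']]
    have "k' \<otimes> I = k \<otimes> I"
      by (rule invertible_cancel_left[OF inv])
        (use k' k'c k(1-3) keq k1 O T in \<open>simp_all add: tensor_assoc\<close>)
    then show "k' = k"
      by (rule rho.faithful[rotated -1]) (use k'c k in simp_all)
  qed
  then show "Kr X Y \<in> Cells C" "dom2 C (Kr X Y) = X \<otimes> rho Y" "cod2 C (Kr X Y) = rho (X \<otimes> Y)"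
    "src C (Kr X Y) = X \<otimes> (Y \<otimes> I)" "tgt C (Kr X Y) = X \<otimes> Y"
    "(X \<otimes> K Y I) \<bullet> (Kr X Y \<otimes> I) = K (X \<otimes> Y) I"
    using k keq src_dom[OF k(1)] tgt_dom[OF k(1)] T O by simp_all
qed

lemma lam_nat_lam:
  assumes "X \<in> Obj C"
  shows "lam_nat (lam X) \<in> Cells C" "dom2 C (lam_nat (lam X)) = (I \<otimes> lam X) \<star> lam X"
    "cod2 C (lam_nat (lam X)) = lam (I \<otimes> X) \<star> lam X" "invertible (lam_nat (lam X))"
  using lam.naturality_cell[of "lam X"] lam.component[OF assms] by simp_all

text \<open>Right whiskering by the equi-arrow \<open>lam X\<close> is fully faithful, so
  \<open>lam_nat (lam X)\<close> descends to a unique cell.\<close>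

lemma N_left:
  assumes X: "X \<in> Obj C"
  shows "N X \<in> Cells C" "dom2 C (N X) = I \<otimes> lam X" "cod2 C (N X) = lam (I \<otimes> X)"
    "src C (N X) = I \<otimes> (I \<otimes> X)" "tgt C (N X) = I \<otimes> X" "invertible (N X)"
    "N X \<star> lam X = lam_nat (lam X)"
proof -
  note T = lam.component[OF X] lam.component[OF tensor_Obj[OF I_Obj X]] ObjD[OF X]
  note ll = lam_nat_lam[OF X]
  have faithful: "a = b" if "a \<star> lam X = b \<star> lam X" "a \<in> Cells C" "b \<in> Cells C"
    "tgt C a = I \<otimes> X" "dom2 C a = dom2 C b" "cod2 C a = cod2 C b" for a b
    using whisker_right_equi_faithful[OF lam_equi[OF X]] that by simp
  obtain k where k: "k \<in> Cells C" "dom2 C k = I \<otimes> lam X" "cod2 C k = lam (I \<otimes> X)"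
    "k \<star> lam X = lam_nat (lam X)"
    by (rule whisker_right_equi_full[OF lam_equi[OF X] _ _ _ _ _ _ ll(1-3)]) (use T in simp_all)
  obtain j where j: "j \<in> Cells C" "dom2 C j = cod2 C (lam_nat (lam X))"
    "cod2 C j = dom2 C (lam_nat (lam X))" "lam_nat (lam X) \<bullet> j = dom2 C (lam_nat (lam X))"
    "j \<bullet> lam_nat (lam X) = cod2 C (lam_nat (lam X))"
    using ll(4) by (rule invertibleE)
  \<comment> \<open>The inverse of the naturality 2-cell descends too; faithfulness makes both
    composites with \<open>k\<close> identities.\<close>
  obtain k' where k': "k' \<in> Cells C" "dom2 C k' = lam (I \<otimes> X)" "cod2 C k' = I \<otimes> lam X"
    "k' \<star> lam X = j"
    by (rule whisker_right_equi_full[OF lam_equi[OF X], of "lam (I \<otimes> X)" "I \<otimes> lam X" j])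
      (use T j ll in simp_all)
  have t: "tgt C k = I \<otimes> X" "src C k = I \<otimes> (I \<otimes> X)" "tgt C k' = I \<otimes> X"
    using tgt_dom[OF k(1)] src_dom[OF k(1)] tgt_dom[OF k'(1)] k(2) k'(2) T by simp_all
  have "k \<bullet> k' = I \<otimes> lam X" "k' \<bullet> k = lam (I \<otimes> X)"
    by (rule faithful; use k k' t j ll T whisker_right_vcomp[of "lam X" k k']
      whisker_right_vcomp[of "lam X" k' k] in simp)+
  then have inv: "invertible k" using invertibleI[of k k'] k k' by simp
  have "N X = k"
    unfolding N_left_def
  proof (rule the_equality)
    show "k \<in> two_hom C (I \<otimes> lam X) (lam (I \<otimes> X)) \<and> k \<star> lam X = lam_nat (lam X)"
      using k by (simp add: two_hom_def)
    fix i assume i: "i \<in> two_hom C (I \<otimes> lam X) (lam (I \<otimes> X)) \<and> i \<star> lam X = lam_nat (lam X)"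
    note ic = two_homD[OF conjunct1[OF i]]
    show "i = k"
      by (rule faithful) (use ic i k T tgt_dom[OF ic(1)] in simp_all)
  qed
  then show "N X \<in> Cells C" "dom2 C (N X) = I \<otimes> lam X" "cod2 C (N X) = lam (I \<otimes> X)"
    "src C (N X) = I \<otimes> (I \<otimes> X)" "tgt C (N X) = I \<otimes> X" "invertible (N X)"
    "N X \<star> lam X = lam_nat (lam X)"
    using k t inv by simp_all
qed

text \<open>Tensors are nested to the right, the normal form into which \<open>tensor_assoc\<close>
  rewrites in the later calculations.\<close>

lemma K_naturality:
  assumes "f \<in> Cells C" "dom2 C f = f" "g \<in> Cells C" "dom2 C g = g"
  shows "(f \<otimes> lam_nat g) \<bullet> (K (src C f) (src C g) \<star> (f \<otimes> g)) =
    ((f \<otimes> (I \<otimes> g)) \<star> K (tgt C f) (tgt C g)) \<bullet> (rho_nat f \<otimes> g)"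
proof -
  have "f \<in> hom C (src C f) (tgt C f)" "g \<in> hom C (src C g) (tgt C g)"
    using assms by (simp_all add: hom_def)
  then have "(f \<otimes> lam_nat g) \<bullet> (K (src C f) (src C g) \<star> (f \<otimes> g)) =
    ((f \<otimes> I \<otimes> g) \<star> K (tgt C f) (tgt C g)) \<bullet> (rho_nat f \<otimes> g)"
    using K_natural src_Obj tgt_Obj assms unfolding natural_K_def by blast
  then show ?thesis using assms by (simp add: tensor_assoc)
qed

text \<open>At an identity arrow in the other variable, the other naturality 2-cell is an identity.\<close>

lemma K_naturality_left:
  assumes f: "f \<in> Cells C" "dom2 C f = f" and Y: "Y \<in> Obj C"
  shows "K (src C f) Y \<star> (f \<otimes> Y) = ((f \<otimes> (I \<otimes> Y)) \<star> K (tgt C f) Y) \<bullet> (rho_nat f \<otimes> Y)"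
proof -
  note k = K_cell[OF src_Obj[OF f(1)] Y] and T = lam.component[OF Y] and O = ObjD[OF Y]
  \<comment> \<open>Since \<open>lam_nat Y\<close> is \<open>lam Y\<close>, the left factor in the
    naturality equation is the identity 2-cell of this domain and is absorbed.\<close>
  have "f \<otimes> lam Y = dom2 C (K (src C f) Y \<star> (f \<otimes> Y))"
    using k T O f exchange_tensor(2)[of f "lam Y"] by simp
  then have "(f \<otimes> lam Y) \<bullet> (K (src C f) Y \<star> (f \<otimes> Y)) = K (src C f) Y \<star> (f \<otimes> Y)"
    using k f O vertical.comp_unit_left[of "K (src C f) Y \<star> (f \<otimes> Y)"] by simp
  then show ?thesis
    using K_naturality[OF f, of Y] O lam.naturality_Obj[OF Y] by simp
qed

lemma K_naturality_right:
  assumes X: "X \<in> Obj C" and g: "g \<in> Cells C" "dom2 C g = g"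
  shows "(X \<otimes> lam_nat g) \<bullet> (K X (src C g) \<star> (X \<otimes> g)) = (X \<otimes> (I \<otimes> g)) \<star> K X (tgt C g)"
proof -
  note k = K_cell[OF X tgt_Obj[OF g(1)]] and T = rho.component[OF X] and O = ObjD[OF X]
  have "rho X \<otimes> g = cod2 C ((X \<otimes> (I \<otimes> g)) \<star> K X (tgt C g))"
    using k T O g cod_arrow[OF g] exchange_tensor(2)[of "rho X" g] by (simp add: tensor_assoc)
  then have "((X \<otimes> (I \<otimes> g)) \<star> K X (tgt C g)) \<bullet> (rho X \<otimes> g) = (X \<otimes> (I \<otimes> g)) \<star> K X (tgt C g)"
    using k g O vertical.comp_unit_right[of "(X \<otimes> (I \<otimes> g)) \<star> K X (tgt C g)"] by simp
  then show ?thesis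
    using K_naturality[OF O(1,4) g] O rho.naturality_Obj[OF X] by simp
qed

section \<open>Compatibility, coherence and their transport\<close>

definition coherent_left :: "'c \<Rightarrow> 'c \<Rightarrow> 'c \<Rightarrow> bool" where
  "coherent_left X Y Z \<longleftrightarrow> (X \<otimes> Kl Y Z) \<bullet> (K X Y \<otimes> Z) = K X (Y \<otimes> Z)"

definition coherent_right :: "'c \<Rightarrow> 'c \<Rightarrow> 'c \<Rightarrow> bool" where
  "coherent_right X Y Z \<longleftrightarrow> (X \<otimes> K Y Z) \<bullet> (Kr X Y \<otimes> Z) = K (X \<otimes> Y) Z"

text \<open>Like the two coherence predicates, this is stated at fixed objects: the argument passes
  between individual pairs and triples.\<close>

definition compatible :: "'c \<Rightarrow> 'c \<Rightarrow> bool" where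
  "compatible X Y \<longleftrightarrow> (K X I \<otimes> Y \<star> X \<otimes> lam Y) \<bullet> (X \<otimes> (N Y \<bullet> Kl I Y) \<star> rho X \<otimes> Y) =
     X \<otimes> lam I \<otimes> Y \<star> K X Y"

text \<open>Every factor introduced or removed is invertible or a whiskering by an equi-arrow, so
  the calculation is a chain of equivalences and serves both directions.\<close>

lemma compatible_iff_coherent_left:
  assumes X: "X \<in> Obj C" and Y: "Y \<in> Obj C"
  shows "compatible X Y \<longleftrightarrow> coherent_left X I Y"
proof -
  note IY = tensor_Obj[OF I_Obj Y]
  note O = ObjD[OF X] ObjD[OF Y] ObjD[OF IY]
  note T = lam.component[OF Y] lam.component[OF I_Obj] lam.component[OF IY] rho.component[OF X]
  \<comment> \<open>The names hide the tensors: once boundaries and invertibility are recorded, the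
    rest is a computation with the two compositions alone.\<close>
  define w where "w = X \<otimes> lam Y"
  define r where "r = rho X \<otimes> Y"
  define s where "s = X \<otimes> (lam I \<otimes> Y)"
  define k where "k = K X Y"
  define q where "q = K X (I \<otimes> Y)"
  define R where "R = K X I \<otimes> Y"
  define M where "M = X \<otimes> N Y"
  define A where "A = X \<otimes> Kl I Y"
  note defs = w_def r_def s_def k_def q_def R_def M_def A_def
  have w: "w \<in> Cells C" "dom2 C w = w" "cod2 C w = w" "src C w = X \<otimes> (I \<otimes> Y)" "tgt C w = X \<otimes> Y"
    and r: "r \<in> Cells C" "dom2 C r = r" "cod2 C r = r" "src C r = X \<otimes> (I \<otimes> Y)" "tgt C r = X \<otimes> Y"
    using O T by (simp_all add: defs tensor_assoc)
  note k = K_cell[OF X Y, folded k_def w_def r_def]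
  have q: "q \<in> Cells C" "dom2 C q = X \<otimes> lam (I \<otimes> Y)" "cod2 C q = rho X \<otimes> (I \<otimes> Y)"
    "tgt C q = X \<otimes> (I \<otimes> Y)"
    using K_cell[OF X IY] by (simp_all add: defs)
  have R: "R \<in> Cells C" "dom2 C R = s" "cod2 C R = rho X \<otimes> (I \<otimes> Y)" "tgt C R = X \<otimes> (I \<otimes> Y)"
    using K_cell[OF X I_Obj] O T by (simp_all add: defs tensor_assoc)
  have M: "M \<in> Cells C" "dom2 C M = X \<otimes> (I \<otimes> lam Y)" "cod2 C M = X \<otimes> lam (I \<otimes> Y)"
    "tgt C M = X \<otimes> (I \<otimes> Y)" "invertible M"
    using N_left[OF Y] O T functor_invertible[OF tensor_functors(1)[OF X]] by (simp_all add: defs)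
  have A: "A \<in> Cells C" "dom2 C A = X \<otimes> lam (I \<otimes> Y)" "cod2 C A = s"
    "tgt C A = X \<otimes> (I \<otimes> Y)" "invertible A"
    using K_left[OF I_Obj Y] O T functor_invertible[OF tensor_functors(1)[OF X]] by (simp_all add: defs)
  text \<open>\<open>P\<close> is \<open>X \<otimes> L Y\<close>. Precomposing the compatibility equation with \<open>P \<star> w\<close> lets the naturality of \<open>K\<close>
    at \<open>lam Y\<close> rewrite its right-hand side, after which \<open>P \<star> r\<close>, \<open>w\<close> and \<open>M\<close> cancel.\<close>
  define P where "P = M \<bullet> A"
  have P: "P \<in> Cells C" "dom2 C P = X \<otimes> (I \<otimes> lam Y)" "cod2 C P = s" "tgt C P = X \<otimes> (I \<otimes> Y)"
    "invertible P"
    unfolding P_def using M A invertible_vcomp by simp_all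
  have L: "X \<otimes> (N Y \<bullet> Kl I Y) = P"
    unfolding P_def M_def A_def using N_left[OF Y] K_left[OF I_Obj Y] by (intro tensor_left(2)[OF X]) simp_all
  \<comment> \<open>This is where \<open>N\<close> earns its definition:
    \<open>N Y \<star> lam Y\<close> is the naturality 2-cell that occurs in the naturality of
    \<open>K\<close> at \<open>lam Y\<close>.\<close>
  have N_nat: "(M \<bullet> q) \<star> w = (X \<otimes> (I \<otimes> lam Y)) \<star> k"
  proof -
    have "M \<star> w = X \<otimes> lam_nat (lam Y)"
      unfolding M_def w_def using N_left[OF Y] T tensor_left(1)[OF X, of "N Y" "lam Y"] by simp
    then show ?thesis
      using K_naturality_right[OF X, of "lam Y"] T whisker_right_vcomp[of w M q] w M q
      by (simp add: k_def q_def w_def)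
  qed
  have c: "rho X \<otimes> (I \<otimes> Y) \<star> w = X \<otimes> (I \<otimes> lam Y) \<star> r"
    unfolding w_def r_def using exchange_tensor[of "rho X" "lam Y"] T O by (simp add: tensor_assoc)
  have eq_R: "(P \<star> w) \<bullet> ((R \<star> w) \<bullet> (P \<star> r)) = ((P \<bullet> R) \<star> w) \<bullet> (P \<star> r)"
    using whisker_right_vcomp[of w P R] vertical.comp_assoc[of "P \<star> w" "R \<star> w" "P \<star> r"] w P R r c
    by simp
  \<comment> \<open>Both sides equal \<open>P \<star> k\<close>, factored in the two possible
    orders; \<open>N_nat\<close> rewrites the factor whiskered by the domain of
    \<open>P\<close>.\<close>
  have eq_q: "(P \<star> w) \<bullet> (s \<star> k) = ((M \<bullet> q) \<star> w) \<bullet> (P \<star> r)"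
    using exchange[of P k] P k N_nat by simp
  have sk: "s \<star> k \<in> Cells C" "dom2 C (s \<star> k) = s \<star> w"
    using P k cod_arrow[of s] by (auto simp: s_def w_def O T)
  have "compatible X Y \<longleftrightarrow> (R \<star> w) \<bullet> (P \<star> r) = s \<star> k"
    unfolding compatible_def L defs[symmetric]
    using O T by (simp add: tensor_assoc defs)
  also have "\<dots> \<longleftrightarrow> (P \<star> w) \<bullet> ((R \<star> w) \<bullet> (P \<star> r)) = (P \<star> w) \<bullet> (s \<star> k)"
    using invertible_cancel_left[OF invertible_whisker_right[OF P(5) w(1,2)],
        of "(R \<star> w) \<bullet> (P \<star> r)" "s \<star> k"] P R w r sk c by auto
  also have "\<dots> \<longleftrightarrow> ((P \<bullet> R) \<star> w) \<bullet> (P \<star> r) = ((M \<bullet> q) \<star> w) \<bullet> (P \<star> r)"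
    unfolding eq_R eq_q ..
  also have "\<dots> \<longleftrightarrow> (P \<bullet> R) \<star> w = (M \<bullet> q) \<star> w"
    using invertible_cancel_right[OF invertible_whisker_right[OF P(5) r(1,2)],
        of "(P \<bullet> R) \<star> w" "(M \<bullet> q) \<star> w"] P R w r M q c by auto
  also have "\<dots> \<longleftrightarrow> P \<bullet> R = M \<bullet> q"
    using whisker_right_equi_faithful[OF functor_equi_arrow[OF tensor_functors(1)[OF X] lam_equi[OF Y]],
        of "P \<bullet> R" "M \<bullet> q"] P R M q by (auto simp: w_def)
  also have "\<dots> \<longleftrightarrow> M \<bullet> (A \<bullet> R) = M \<bullet> q"
    unfolding P_def using M A R by (simp add: vertical.comp_assoc)
  also have "\<dots> \<longleftrightarrow> A \<bullet> R = q"
    using invertible_cancel_left[OF M(5), of "A \<bullet> R" q] M A R q by auto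
  also have "\<dots> \<longleftrightarrow> coherent_left X I Y"
    by (simp add: coherent_left_def defs)
  finally show ?thesis .
qed

text \<open>Left coherence at (Y, I, Z) splits K_{Y,IZ}. Its factor K_{Y,I} Z, tensored with X,
  meets K^\<rho>_{X,Y} I Z in the defining equation of \<open>Kr\<close> tensored with Z; left
  coherence at (XY, I, Z) reassembles the result.\<close>

lemma coherent_left_unit_imp_right:
  assumes coh: "\<And>X Z. \<lbrakk>X \<in> Obj C; Z \<in> Obj C\<rbrakk> \<Longrightarrow> coherent_left X I Z"
    and X: "X \<in> Obj C" and Y: "Y \<in> Obj C" and Z: "Z \<in> Obj C"
  shows "coherent_right X Y (I \<otimes> Z)"
proof -
  note XY = tensor_Obj[OF X Y]
  note O = ObjD[OF X] ObjD[OF Y] ObjD[OF Z] ObjD[OF XY]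
  note T = lam.component[OF I_Obj] rho.component[OF Y] rho.component[OF XY]
  note l = K_left[OF I_Obj Z] and k = K_cell[OF Y I_Obj] and R = K_right[OF X Y]
  have "(X \<otimes> K Y (I \<otimes> Z)) \<bullet> (Kr X Y \<otimes> (I \<otimes> Z))
      = ((X \<otimes> (Y \<otimes> Kl I Z)) \<bullet> (X \<otimes> (K Y I \<otimes> Z))) \<bullet> (Kr X Y \<otimes> (I \<otimes> Z))"
    using coh[OF Y Z, unfolded coherent_left_def, symmetric]
      tensor_left(2)[OF X, of "Y \<otimes> Kl I Z" "K Y I \<otimes> Z"] l k O T by (simp add: tensor_assoc)
  also have "\<dots> = (X \<otimes> (Y \<otimes> Kl I Z)) \<bullet> ((X \<otimes> (K Y I \<otimes> Z)) \<bullet> (Kr X Y \<otimes> (I \<otimes> Z)))"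
    using l k R O T by (intro vertical.comp_assoc) (simp_all add: tensor_assoc)
  also have "(X \<otimes> (K Y I \<otimes> Z)) \<bullet> (Kr X Y \<otimes> (I \<otimes> Z)) = K (X \<otimes> Y) I \<otimes> Z"
    using tensor_right(2)[OF Z, of "X \<otimes> K Y I" "Kr X Y \<otimes> I"] R k O T by (simp add: tensor_assoc)
  also have "(X \<otimes> (Y \<otimes> Kl I Z)) \<bullet> (K (X \<otimes> Y) I \<otimes> Z) = K (X \<otimes> Y) (I \<otimes> Z)"
    using coh[OF XY Z, unfolded coherent_left_def] l O by (simp add: tensor_assoc)
  finally show ?thesis by (simp add: coherent_right_def)
qed

text \<open>The mirror argument: right coherence at (X, I, Y) splits K_{XI,Y}, the defining equation
  of \<open>Kl\<close> tensored with X combines the two inner factors, and right coherence at (X, I,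
  YZ) reassembles.\<close>

lemma coherent_right_unit_imp_left:
  assumes coh: "\<And>X Z. \<lbrakk>X \<in> Obj C; Z \<in> Obj C\<rbrakk> \<Longrightarrow> coherent_right X I Z"
    and X: "X \<in> Obj C" and Y: "Y \<in> Obj C" and Z: "Z \<in> Obj C"
  shows "coherent_left (X \<otimes> I) Y Z"
proof -
  note XI = tensor_Obj[OF X I_Obj] and YZ = tensor_Obj[OF Y Z]
  note O = ObjD[OF X] ObjD[OF Y] ObjD[OF Z] ObjD[OF XI] ObjD[OF YZ]
  note T = rho.component[OF I_Obj] lam.component[OF Y] rho.component[OF XI]
  note l = K_left[OF Y Z] and k = K_cell[OF I_Obj Y] and R = K_right[OF X I_Obj]
  have "((X \<otimes> I) \<otimes> Kl Y Z) \<bullet> (K (X \<otimes> I) Y \<otimes> Z)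
      = (X \<otimes> (I \<otimes> Kl Y Z)) \<bullet> ((X \<otimes> (K I Y \<otimes> Z)) \<bullet> (Kr X I \<otimes> (Y \<otimes> Z)))"
    using coh[OF X Y, unfolded coherent_right_def, symmetric]
      tensor_right(2)[OF Z, of "X \<otimes> K I Y" "Kr X I \<otimes> Y"] l k R O T by (simp add: tensor_assoc)
  also have "\<dots> = ((X \<otimes> (I \<otimes> Kl Y Z)) \<bullet> (X \<otimes> (K I Y \<otimes> Z))) \<bullet> (Kr X I \<otimes> (Y \<otimes> Z))"
    using l k R O T by (intro vertical.comp_assoc[symmetric]) (simp_all add: tensor_assoc)
  also have "(X \<otimes> (I \<otimes> Kl Y Z)) \<bullet> (X \<otimes> (K I Y \<otimes> Z)) = X \<otimes> K I (Y \<otimes> Z)"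
    using tensor_left(2)[OF X, of "I \<otimes> Kl Y Z" "K I Y \<otimes> Z"] l k O T by (simp add: tensor_assoc)
  also have "(X \<otimes> K I (Y \<otimes> Z)) \<bullet> (Kr X I \<otimes> (Y \<otimes> Z)) = K (X \<otimes> I) (Y \<otimes> Z)"
    using coh[OF X YZ, unfolded coherent_right_def] .
  finally show ?thesis by (simp add: coherent_left_def)
qed

text \<open>Naturality in the first variable moves both sides of the equation from X to X' with the
  same correction \<open>rho_nat f \<otimes> (Y \<otimes> Z)\<close>. That correction is invertible,
  and the remaining whiskering is by an equi-arrow, the image of \<open>f\<close> under a tensor
  functor.\<close>

lemma coherent_left_transport:
  assumes f: "equi_arrow C f X X'" and X: "X \<in> Obj C" and X': "X' \<in> Obj C"
    and Y: "Y \<in> Obj C" and Z: "Z \<in> Obj C" and coh: "coherent_left X Y Z"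
  shows "coherent_left X' Y Z"
proof -
  note F = equi_arrowD[OF f] and YZ = tensor_Obj[OF Y Z]
  note O = ObjD[OF X] ObjD[OF X'] ObjD[OF Y] ObjD[OF Z] ObjD[OF YZ]
  note T = lam.component[OF Y] lam.component[OF YZ] rho.component[OF X] rho.component[OF X']
  note l = K_left[OF Y Z] and k = K_cell[OF X Y] K_cell[OF X' Y] K_cell[OF X YZ] K_cell[OF X' YZ]
  note n = rho.naturality_cell[OF F(1,4)]
  let ?g = "f \<otimes> (I \<otimes> (Y \<otimes> Z))"
  have inv: "invertible (rho_nat f \<otimes> (Y \<otimes> Z))"
    by (rule functor_invertible[OF tensor_functors(2)[OF YZ] n(4)])
  have sn: "src C (rho_nat f) = X \<otimes> I" "tgt C (rho_nat f) = X'"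
    using src_dom[OF n(1)] tgt_dom[OF n(1)] n F T by simp_all
  have nat1: "K X (Y \<otimes> Z) \<star> (f \<otimes> (Y \<otimes> Z)) = (?g \<star> K X' (Y \<otimes> Z)) \<bullet> (rho_nat f \<otimes> (Y \<otimes> Z))"
    using K_naturality_left[OF F(1,4) YZ] F by simp
  \<comment> \<open>The boundary equality that makes the composites with
    \<open>rho_nat f \<otimes> W\<close> well formed.\<close>
  have dom_nat: "(f \<otimes> (I \<otimes> W)) \<star> (rho X' \<otimes> W) = (f \<otimes> I \<star> rho X') \<otimes> W" if "W \<in> Obj C" for W
    using tensor_right(1)[OF that, of "f \<otimes> I" "rho X'"] ObjD[OF that] F T by (simp add: tensor_assoc)
  have nat2: "(K X Y \<otimes> Z) \<star> (f \<otimes> (Y \<otimes> Z)) = (?g \<star> (K X' Y \<otimes> Z)) \<bullet> (rho_nat f \<otimes> (Y \<otimes> Z))"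
    using K_naturality_left[OF F(1,4) Y] F k O n sn T dom_nat[OF Y]
      tensor_right(1)[OF Z, of "K X Y" "f \<otimes> Y"] tensor_right(1)[OF Z, of "f \<otimes> (I \<otimes> Y)" "K X' Y"]
      tensor_right(2)[OF Z, of "(f \<otimes> (I \<otimes> Y)) \<star> K X' Y" "rho_nat f \<otimes> Y"]
    by (simp add: tensor_assoc)
  \<comment> \<open>\<open>Kl Y Z\<close> does not involve the first variable, so it slides past
    \<open>f\<close> without any correction.\<close>
  have ex: "(X \<otimes> Kl Y Z) \<star> (f \<otimes> (Y \<otimes> Z)) = ?g \<star> (X' \<otimes> Kl Y Z)"
    using exchange_tensor[of f "Kl Y Z"] l F by simp
  let ?c = "(X' \<otimes> Kl Y Z) \<bullet> (K X' Y \<otimes> Z)"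
  have c: "?c \<in> Cells C" "dom2 C ?c = X' \<otimes> lam (Y \<otimes> Z)" "cod2 C ?c = rho X' \<otimes> (Y \<otimes> Z)"
    "src C ?c = X' \<otimes> (I \<otimes> (Y \<otimes> Z))"
    using l k O T by (simp_all add: tensor_assoc)
  have "(?g \<star> K X' (Y \<otimes> Z)) \<bullet> (rho_nat f \<otimes> (Y \<otimes> Z))
      = ((X \<otimes> Kl Y Z) \<bullet> (K X Y \<otimes> Z)) \<star> (f \<otimes> (Y \<otimes> Z))"
    using nat1 coh by (simp add: coherent_left_def)
  also have "\<dots> = (?g \<star> (X' \<otimes> Kl Y Z)) \<bullet> ((?g \<star> (K X' Y \<otimes> Z)) \<bullet> (rho_nat f \<otimes> (Y \<otimes> Z)))"
    using whisker_right_vcomp[of "f \<otimes> (Y \<otimes> Z)" "X \<otimes> Kl Y Z" "K X Y \<otimes> Z"] nat2 ex l k O F T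
    by (simp add: tensor_assoc)
  also have "\<dots> = ((?g \<star> (X' \<otimes> Kl Y Z)) \<bullet> (?g \<star> (K X' Y \<otimes> Z))) \<bullet> (rho_nat f \<otimes> (Y \<otimes> Z))"
    using n sn l k O F T dom_nat[OF YZ]
    by (intro vertical.comp_assoc[symmetric]) (simp_all add: tensor_assoc)
  also have "(?g \<star> (X' \<otimes> Kl Y Z)) \<bullet> (?g \<star> (K X' Y \<otimes> Z)) = ?g \<star> ?c"
    using whisker_left_vcomp[of ?g "X' \<otimes> Kl Y Z" "K X' Y \<otimes> Z"] l k O F T
    by (simp add: tensor_assoc)
  finally have "?g \<star> K X' (Y \<otimes> Z) = ?g \<star> ?c"
    by (rule invertible_cancel_right[OF inv, rotated -1])
      (use c k n sn F O T dom_nat[OF YZ] in \<open>simp_all add: tensor_assoc\<close>)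
  then have "K X' (Y \<otimes> Z) = ?c"
    by (rule whisker_equi_faithful[OF functor_equi_arrow[OF tensor_functors(2) f], rotated -1])
      (use c k O F I_Obj YZ in \<open>simp_all add: tensor_Obj\<close>)
  then show ?thesis by (simp add: coherent_left_def)
qed

text \<open>Naturality in the last variable places \<open>lam_nat g\<close> on the side of the known
  object Z. Coherence at Z can therefore be substituted directly, and only a whiskering by the
  equi-arrow X Y I g is left to cancel.\<close>

lemma coherent_right_transport:
  assumes g: "equi_arrow C g Z Z'" and Z: "Z \<in> Obj C" and Z': "Z' \<in> Obj C"
    and X: "X \<in> Obj C" and Y: "Y \<in> Obj C" and coh: "coherent_right X Y Z"
  shows "coherent_right X Y Z'"
proof -
  note G = equi_arrowD[OF g] and XY = tensor_Obj[OF X Y]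
  note O = ObjD[OF X] ObjD[OF Y] ObjD[OF Z] ObjD[OF Z'] ObjD[OF XY]
  note T = rho.component[OF Y] rho.component[OF XY] lam.component[OF Z] lam.component[OF Z']
  note R = K_right[OF X Y] and k = K_cell[OF Y Z] K_cell[OF Y Z'] K_cell[OF XY Z] K_cell[OF XY Z']
  note n = lam.naturality_cell[OF G(1,4)]
  let ?h = "X \<otimes> (Y \<otimes> (I \<otimes> g))" and ?g = "X \<otimes> (Y \<otimes> g)" and ?n = "X \<otimes> (Y \<otimes> lam_nat g)"
  have sn: "src C (lam_nat g) = I \<otimes> Z" "tgt C (lam_nat g) = Z'"
    using src_dom[OF n(1)] tgt_dom[OF n(1)] n G T by simp_all
  have nat1: "?n \<bullet> (K (X \<otimes> Y) Z \<star> ?g) = ?h \<star> K (X \<otimes> Y) Z'"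
    using K_naturality_right[OF XY G(1,4)] G n O by (simp add: tensor_assoc)
  \<comment> \<open>These two equalities match the codomain of \<open>?n\<close> with the domain of
    the whiskered cell that follows it.\<close>
  have cn: "Y \<otimes> (lam Z \<star> g) = (Y \<otimes> lam Z) \<star> (Y \<otimes> g)"
    using tensor_left(1)[OF Y, of "lam Z" g] G T by simp
  have cn': "X \<otimes> ((Y \<otimes> lam Z) \<star> (Y \<otimes> g)) = (X \<otimes> (Y \<otimes> lam Z)) \<star> ?g"
    using tensor_left(1)[OF X, of "Y \<otimes> lam Z" "Y \<otimes> g"] G T O by simp
  have nat2: "?n \<bullet> ((X \<otimes> K Y Z) \<star> ?g) = ?h \<star> (X \<otimes> K Y Z')"
    using K_naturality_right[OF Y G(1,4)] G k O n sn T cn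
      tensor_left(1)[OF X, of "K Y Z" "Y \<otimes> g"] tensor_left(1)[OF X, of "Y \<otimes> (I \<otimes> g)" "K Y Z'"]
      tensor_left(2)[OF X, of "Y \<otimes> lam_nat g" "K Y Z \<star> (Y \<otimes> g)"]
    by (simp add: tensor_assoc)
  have ex: "(Kr X Y \<otimes> Z) \<star> ?g = ?h \<star> (Kr X Y \<otimes> Z')"
    using exchange_tensor[of "Kr X Y" g] R G O by (simp add: tensor_assoc)
  let ?c = "(X \<otimes> K Y Z') \<bullet> (Kr X Y \<otimes> Z')"
  have c: "?c \<in> Cells C" "dom2 C ?c = X \<otimes> (Y \<otimes> lam Z')" "cod2 C ?c = rho (X \<otimes> Y) \<otimes> Z'"
    "src C ?c = X \<otimes> (Y \<otimes> (I \<otimes> Z'))"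
    using R k O T by (simp_all add: tensor_assoc)
  have "?h \<star> K (X \<otimes> Y) Z' = ?n \<bullet> (((X \<otimes> K Y Z) \<bullet> (Kr X Y \<otimes> Z)) \<star> ?g)"
    using nat1 coh by (simp add: coherent_right_def)
  also have "\<dots> = ?n \<bullet> (((X \<otimes> K Y Z) \<star> ?g) \<bullet> ((Kr X Y \<otimes> Z) \<star> ?g))"
    using whisker_right_vcomp[of ?g "X \<otimes> K Y Z" "Kr X Y \<otimes> Z"] R k O G T
    by (simp add: tensor_assoc)
  also have "\<dots> = (?n \<bullet> ((X \<otimes> K Y Z) \<star> ?g)) \<bullet> ((Kr X Y \<otimes> Z) \<star> ?g)"
    using R k O G T n sn cn cn' by (intro vertical.comp_assoc[symmetric]) (simp_all add: tensor_assoc)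
  also have "\<dots> = ?h \<star> ?c"
    unfolding nat2 ex
    using whisker_left_vcomp[of ?h "X \<otimes> K Y Z'" "Kr X Y \<otimes> Z'"] R k O G T
    by (simp add: tensor_assoc)
  finally have "?h \<star> K (X \<otimes> Y) Z' = ?h \<star> ?c" .
  then have "K (X \<otimes> Y) Z' = ?c"
    by (rule whisker_equi_faithful[OF functor_equi_arrow[OF tensor_functors(1)[OF X]
          functor_equi_arrow[OF tensor_functors(1)[OF Y]
            functor_equi_arrow[OF tensor_functors(1)[OF I_Obj] g]]], rotated -1])
      (use c k O G T in \<open>simp_all add: tensor_assoc\<close>)
  then show ?thesis by (simp add: coherent_right_def)
qed

text \<open>The implications close the cycle (ii), (i), (ii'), (ii): the case of middle object
  \<open>I\<close> already recovers all of (ii), by way of (ii').\<close>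

lemma coherence_equivalences:
  shows "(\<forall>X \<in> Obj C. \<forall>Y \<in> Obj C. compatible X Y) \<longleftrightarrow>
      (\<forall>X \<in> Obj C. \<forall>Y \<in> Obj C. \<forall>Z \<in> Obj C. coherent_left X Y Z)" (is "?i \<longleftrightarrow> ?ii")
    and "(\<forall>X \<in> Obj C. \<forall>Y \<in> Obj C. \<forall>Z \<in> Obj C. coherent_left X Y Z) \<longleftrightarrow>
      (\<forall>X \<in> Obj C. \<forall>Y \<in> Obj C. \<forall>Z \<in> Obj C. coherent_right X Y Z)" (is "_ \<longleftrightarrow> ?ii'")
proof -
  have 1: ?i if ?ii using that compatible_iff_coherent_left I_Obj by blast
  have 2: ?ii' if ?i
  proof (intro ballI)
    fix X Y Z assume XYZ: "X \<in> Obj C" "Y \<in> Obj C" "Z \<in> Obj C"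
    have "coherent_left X I Z" if "X \<in> Obj C" "Z \<in> Obj C" for X Z
      using \<open>?i\<close> that compatible_iff_coherent_left[OF that] by blast
    then have "coherent_right X Y (I \<otimes> Z)"
      using XYZ by (rule coherent_left_unit_imp_right)
    then show "coherent_right X Y Z"
      by (rule coherent_right_transport[OF lam_equi tensor_Obj[OF I_Obj], rotated -1]) (fact XYZ)+
  qed
  have 3: ?ii if ?ii'
  proof (intro ballI)
    fix X Y Z assume XYZ: "X \<in> Obj C" "Y \<in> Obj C" "Z \<in> Obj C"
    have "coherent_right X I Z" if "X \<in> Obj C" "Z \<in> Obj C" for X Z
      using \<open>?ii'\<close> that I_Obj by blast
    then have "coherent_left (X \<otimes> I) Y Z"
      using XYZ by (rule coherent_right_unit_imp_left)
    then show "coherent_left X Y Z"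
      by (rule coherent_left_transport[OF rho_equi tensor_Obj[OF _ I_Obj], rotated -1]) (fact XYZ)+
  qed
  show "?i \<longleftrightarrow> ?ii" "?ii \<longleftrightarrow> ?ii'" using 1 2 3 by blast+
qed

end


theorem proposition7p8:
  fixes C :: "('c, 'm) tensor_two_cat_scheme" (structure)
    and I :: 'c
    and lam lam_nat rho rho_nat :: "'c \<Rightarrow> 'c"
    and K :: "'c \<Rightarrow> 'c \<Rightarrow> 'c"
  assumes "semi_monoidal_two_category C"
    and "I \<in> Obj C"
    and "pseudo_natural C C (\<lambda>a. I \<otimes> a) (\<lambda>a. a) lam lam_nat"
    and "pseudo_natural C C (\<lambda>a. a \<otimes> I) (\<lambda>a. a) rho rho_nat"
    and "\<And>X. X \<in> Obj C \<Longrightarrow> equi_arrow C (lam X) (I \<otimes> X) X"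
    and "\<And>X. X \<in> Obj C \<Longrightarrow> equi_arrow C (rho X) (X \<otimes> I) X"
    and "\<And>X Y. \<lbrakk>X \<in> Obj C; Y \<in> Obj C\<rbrakk> \<Longrightarrow> K X Y \<in> inv_two_hom C (X \<otimes> lam Y) (rho X \<otimes> Y)"
    and "natural_K C I lam lam_nat rho rho_nat K"
  shows "let Kl = K_left C I lam K;
             Kr = K_right C I rho K;
             \<alpha> = lam I;
             L = (\<lambda>X. N_left C I lam lam_nat X \<bullet> Kl I X);
             R = (\<lambda>X. K X I);
             compatible = (\<forall>X \<in> Obj C. \<forall>Y \<in> Obj C.
               (R X \<otimes> Y \<star> X \<otimes> lam Y) \<bullet> (X \<otimes> L Y \<star> rho X \<otimes> Y) = X \<otimes> \<alpha> \<otimes> Y \<star> K X Y);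
             left_coherent = (\<forall>X \<in> Obj C. \<forall>Y \<in> Obj C. \<forall>Z \<in> Obj C.
               (X \<otimes> Kl Y Z) \<bullet> (K X Y \<otimes> Z) = K X (Y \<otimes> Z));
             right_coherent = (\<forall>X \<in> Obj C. \<forall>Y \<in> Obj C. \<forall>Z \<in> Obj C.
               (X \<otimes> K Y Z) \<bullet> (Kr X Y \<otimes> Z) = K (X \<otimes> Y) Z)
         in (compatible \<longleftrightarrow> left_coherent) \<and> (left_coherent \<longleftrightarrow> right_coherent)"
proof -
  interpret tensor_with_unit C I lam lam_nat rho rho_nat K
    by (rule tensor_with_unit.intro[OF assms(1)]) (unfold_locales; fact assms)
  show ?thesis
    unfolding Let_def
    by (intro conjI coherence_equivalences[unfolded compatible_def coherent_left_def coherent_right_def])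
qed

end
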